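(* In the setting of the context (in particular $t=t_n$ is a primitive, hyperexponential or hypertangent monomial over $E$), let $f\in L^*$ have an elementary integral over $L$, and let $v,c_i,u_i$ be a representation $f=Dv+\sum_{i}c_iDu_i/u_i$ having the properties (A) and (B) listed in the context. Then: (a) if $t$ is primitive: $v_\infty(v)\ge\min\bigl(0,v_\infty(f)\bigr)-1$; (b) if $t$ is hyperexponential: $v_\infty(v)\ge\min\bigl(0,v_\infty(f)\bigr)$; (c) if $t$ is hypertangent: $v_\infty(v)\ge\min\bigl(0,v_\infty(f)+1\bigr)$, and $v_\infty(u_i)=0$ for every $i$ unless $v_\infty(f)\le-1$.
   Context: All fields have characteristic $0$; $\overline F$ is an algebraic closure of $F$. $(L,D)$ is a differential field built as follows. (T1) $K_0=F(t_1,\dots,t_j)$ with $DF\subseteq F$, each $t_i$ transcendental over $F(t_1,\dots,t_{i-1})$ and $Dt_i\in F(t_1,\dots,t_i)$; $R_0=F[t_1,\dots,t_j]$. (T2) $y^m=q\in R_0$, where $q$ is $m$-th-power-free and $Y^m-q$ is irreducible over $\overline F(t_1,\dots,t_j)$. (T3) $t_{j+1},\dots,t_n$ are successively transcendental over the field below, with $Dt_i\in K_0(y)(t_{j+1},\dots,t_i)$. (T4) $L=K_0(y)(t_{j+1},\dots,t_n)$ has field of constants $F$. Put $t:=t_n$, $E:=K_0(y)(t_{j+1},\dots,t_{n-1})$, so that $L=E(t)$, and let $v_\infty(a/b)=\deg_tb-\deg_ta$ ($a,b\in E[t]$, $b\neq 0$; extended to $\overline F L$ in the same way). $t$ is assumed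 to be a monomial over $E$: primitive ($Dt=w$), hyperexponential ($Dt=wt$) or hypertangent ($Dt=w(1+t^2)$), with $w\in E^*$. $D$ extends uniquely to $\overline F L$ with $D\overline F=0$. $f$ has an elementary integral over $L$ if $f=Dg$ for some $g$ in an elementary extension of $L$. Let $\mathcal O$ be the integral closure of $R_0$ in $K_0(y)$, $\mathcal A=\mathcal O[t_{j+1},\dots,t_n]$, and $\overline F\mathcal A=\overline F\otimes_F\mathcal A$ (a Krull domain). For a height-one prime $P$ of $\overline F\mathcal A$ with valuation $v_P$ put $\eta_P:=\max(0,\sup_{a\ne0}(-v_P(Da)))$ ($a\in\overline F\mathcal A$; finite), $\delta_P=1+\eta_P$; $P$ is normal if $\eta_P+v_P(D\pi)=0$ for a uniformiser $\pi$, special otherwise. If $f$ has an elementary integral there is a representation $f=Dv+\sum_ic_iDu_i/u_i$ with $v\in L$, $c_i\in\overline F$, $u_i\in(\overline F L)^*$ such that: (A) at every normal $P$, $v_P(v)\ge\min(0,v_P(f)+\delta_P)$, with equality $v_P(v)=v_P(f)+\delta_P$ whenever $v_P(v)<0$ (so the polar divisor of $v$ restricted to the normal primes is at most $\sum(-v_P(f)-\delta_P)P$ over normal $P$ with $v_P(f)\le-\delta_P-1$); (B) every $\operatorname{div}(u_i)$ is supported on $S=\{P\text{ special}\}\cup\{P\text{ normal}:v_P(f)\le-\delta_P\}$.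
   Formalization: In (c), the claim that all v_∞(u_i)=0 unless v_∞(f)≤-1 is proved only when the c_i are linearly independent over Q; without this it fails, e.g. t=tan x, f=Dt/t-D(t+1)/(t+1), v=0. *)

theory Defs
  imports
    Complex_Main
    "HOL.Hull"
    "HOL-Library.Extended_Real"
    "HOL-Computational_Algebra.Polynomial"
begin

text \<open>
  All rings and fields are subsets of one ambient field, the type \<open>'a\<close>, which carries a
  derivation \<open>D\<close>. The ambient field is arbitrary: it may be any differential field that contains
  \<open>L\<close>, an algebraic closure of \<open>F\<close> and the elementary extensions of \<open>L\<close> under consideration.
  (For instance, an algebraic closure of an elementary extension of \<open>L\<close> is such a field.)
\<close>

section \<open>Subrings and subfields of an ambient ring\<close>

definition is_subring :: "'a::comm_ring_1 set \<Rightarrow> bool" where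
  "is_subring R \<longleftrightarrow> 1 \<in> R \<and> (\<forall>x\<in>R. \<forall>y\<in>R. x - y \<in> R \<and> x * y \<in> R)"

definition is_subfield :: "'a::field set \<Rightarrow> bool" where
  "is_subfield K \<longleftrightarrow> is_subring K \<and> (\<forall>x\<in>K. inverse x \<in> K)"

definition ring_adjoin :: "'a::comm_ring_1 set \<Rightarrow> 'a set \<Rightarrow> 'a set" where
  "ring_adjoin R X = is_subring hull (R \<union> X)"

definition field_adjoin :: "'a::field set \<Rightarrow> 'a set \<Rightarrow> 'a set" where
  "field_adjoin K X = is_subfield hull (K \<union> X)"

definition unit_in :: "'a::comm_ring_1 set \<Rightarrow> 'a \<Rightarrow> bool" where
  "unit_in R x \<longleftrightarrow> x \<in> R \<and> (\<exists>y\<in>R. x * y = 1)"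

definition irreducible_in :: "'a::comm_ring_1 set \<Rightarrow> 'a \<Rightarrow> bool" where
  "irreducible_in R p \<longleftrightarrow> p \<in> R \<and> p \<noteq> 0 \<and> \<not> unit_in R p \<and>
     (\<forall>a\<in>R. \<forall>b\<in>R. p = a * b \<longrightarrow> unit_in R a \<or> unit_in R b)"

definition power_free_in :: "'a::comm_ring_1 set \<Rightarrow> nat \<Rightarrow> 'a \<Rightarrow> bool" where
  "power_free_in R m q \<longleftrightarrow> (\<forall>p\<in>R. (\<exists>r\<in>R. q = p ^ m * r) \<longrightarrow> unit_in R p)"

definition poly_over :: "'a::comm_ring_1 set \<Rightarrow> 'a poly set" where
  "poly_over R = {p. \<forall>i. coeff p i \<in> R}"

definition algebraic_over :: "'a::field set \<Rightarrow> 'a \<Rightarrow> bool" where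
  "algebraic_over K x \<longleftrightarrow> (\<exists>p\<in>poly_over K. p \<noteq> 0 \<and> poly p x = 0)"

definition transcendental_over :: "'a::field set \<Rightarrow> 'a \<Rightarrow> bool" where
  "transcendental_over K x \<longleftrightarrow> \<not> algebraic_over K x"

definition integral_closure_in :: "'a::comm_ring_1 set \<Rightarrow> 'a set \<Rightarrow> 'a set" where
  "integral_closure_in R K = {x\<in>K. \<exists>p\<in>poly_over R. lead_coeff p = 1 \<and> poly p x = 0}"

definition is_algebraic_closure :: "'a::field set \<Rightarrow> 'a set \<Rightarrow> bool" where
  "is_algebraic_closure F C \<longleftrightarrow> is_subfield C \<and> F \<subseteq> C \<and> (\<forall>x\<in>C. algebraic_over F x) \<and>
     (\<forall>p\<in>poly_over C. degree p > 0 \<longrightarrow> (\<exists>x\<in>C. poly p x = 0))"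

text \<open>Linear independence over the rationals of the family \<open>(c i)\<close>, \<open>i \<in> I\<close>.\<close>

definition rationally_independent :: "'i set \<Rightarrow> ('i \<Rightarrow> 'a::field_char_0) \<Rightarrow> bool" where
  "rationally_independent I c \<longleftrightarrow>
     (\<forall>k :: 'i \<Rightarrow> rat. (\<Sum>i\<in>I. of_rat (k i) * c i) = 0 \<longrightarrow> (\<forall>i\<in>I. k i = 0))"

section \<open>Height-one primes and their valuations\<close>

definition is_ideal_of :: "'a::comm_ring_1 set \<Rightarrow> 'a set \<Rightarrow> bool" where
  "is_ideal_of R I \<longleftrightarrow> I \<subseteq> R \<and> 0 \<in> I \<and> (\<forall>x\<in>I. \<forall>y\<in>I. x + y \<in> I) \<and>
     (\<forall>r\<in>R. \<forall>x\<in>I. r * x \<in> I)"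

definition is_prime_ideal :: "'a::comm_ring_1 set \<Rightarrow> 'a set \<Rightarrow> bool" where
  "is_prime_ideal R P \<longleftrightarrow> is_ideal_of R P \<and> 1 \<notin> P \<and>
     (\<forall>x\<in>R. \<forall>y\<in>R. x * y \<in> P \<longrightarrow> x \<in> P \<or> y \<in> P)"

definition height_one_prime :: "'a::comm_ring_1 set \<Rightarrow> 'a set \<Rightarrow> bool" where
  "height_one_prime R P \<longleftrightarrow> is_prime_ideal R P \<and>
     (\<exists>Q. is_prime_ideal R Q \<and> Q \<subset> P) \<and>
     \<not> (\<exists>Q Q'. is_prime_ideal R Q \<and> is_prime_ideal R Q' \<and> Q \<subset> Q' \<and> Q' \<subset> P)"

definition localization_at :: "'a::field set \<Rightarrow> 'a set \<Rightarrow> 'a set" where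
  "localization_at R P = {a / b | a b. a \<in> R \<and> b \<in> R - P}"

text \<open>A uniformiser generates the maximal ideal \<open>P R\<^sub>P\<close> of the local ring \<open>R\<^sub>P\<close>.\<close>

definition uniformiser :: "'a::field set \<Rightarrow> 'a set \<Rightarrow> 'a \<Rightarrow> bool" where
  "uniformiser R P \<pi> \<longleftrightarrow>
     {a / b | a b. a \<in> P \<and> b \<in> R - P} = (\<lambda>x. \<pi> * x) ` localization_at R P"

text \<open>
  The normalised valuation of the discrete valuation ring \<open>R\<^sub>P\<close>; meaningful only if \<open>R\<^sub>P\<close> is a
  discrete valuation ring (as for a height-one prime of a Krull domain) and on the fraction field
  of \<open>R\<close>. Valuations take integer values or \<open>\<infinity>\<close>; they are placed in \<^typ>\<open>ereal\<close> because the
  supremum in \<open>pole_defect\<close> below needs a complete lattice.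
\<close>

definition prime_val :: "'a::field set \<Rightarrow> 'a set \<Rightarrow> 'a \<Rightarrow> ereal" where
  "prime_val R P x = (if x = 0 then \<infinity> else ereal (of_int
     (THE k::int. \<exists>\<pi>. uniformiser R P \<pi> \<and> unit_in (localization_at R P) (x / \<pi> powi k))))"

text \<open>The order at \<open>\<tau> = \<infinity>\<close> on \<open>K(\<tau>)\<close>, for \<open>\<tau>\<close> transcendental over \<open>K\<close>.\<close>

definition infinity_val :: "'a::field set \<Rightarrow> 'a \<Rightarrow> 'a \<Rightarrow> ereal" where
  "infinity_val K \<tau> x = (if x = 0 then \<infinity> else ereal (of_int
     (THE k::int. \<exists>a\<in>poly_over K. \<exists>b\<in>poly_over K. a \<noteq> 0 \<and> b \<noteq> 0 \<and>
        x = poly a \<tau> / poly b \<tau> \<and> k = int (degree b) - int (degree a))))"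

section \<open>Derivations\<close>

definition is_derivation :: "('a::comm_ring_1 \<Rightarrow> 'a) \<Rightarrow> bool" where
  "is_derivation D \<longleftrightarrow> (\<forall>x y. D (x + y) = D x + D y \<and> D (x * y) = x * D y + D x * y)"

definition is_primitive :: "('a::field \<Rightarrow> 'a) \<Rightarrow> 'a set \<Rightarrow> 'a \<Rightarrow> bool" where
  "is_primitive D K \<tau> \<longleftrightarrow> (\<exists>w\<in>K - {0}. D \<tau> = w)"

definition is_hyperexponential :: "('a::field \<Rightarrow> 'a) \<Rightarrow> 'a set \<Rightarrow> 'a \<Rightarrow> bool" where
  "is_hyperexponential D K \<tau> \<longleftrightarrow> (\<exists>w\<in>K - {0}. D \<tau> = w * \<tau>)"

definition is_hypertangent :: "('a::field \<Rightarrow> 'a) \<Rightarrow> 'a set \<Rightarrow> 'a \<Rightarrow> bool" where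
  "is_hypertangent D K \<tau> \<longleftrightarrow> (\<exists>w\<in>K - {0}. D \<tau> = w * (1 + \<tau>\<^sup>2))"

inductive elementary_extension :: "('a::field \<Rightarrow> 'a) \<Rightarrow> 'a set \<Rightarrow> 'a set \<Rightarrow> bool"
  for D :: "'a \<Rightarrow> 'a" and L :: "'a set" where
  base: "elementary_extension D L L"
| algebraic: "elementary_extension D L M \<Longrightarrow> algebraic_over M \<theta> \<Longrightarrow>
    elementary_extension D L (field_adjoin M {\<theta>})"
| logarithm: "elementary_extension D L M \<Longrightarrow> a \<in> M \<Longrightarrow> a \<noteq> 0 \<Longrightarrow> D \<theta> = D a / a \<Longrightarrow>
    elementary_extension D L (field_adjoin M {\<theta>})"
| exponential: "elementary_extension D L M \<Longrightarrow> a \<in> M \<Longrightarrow> \<theta> \<noteq> 0 \<Longrightarrow> D \<theta> / \<theta> = D a \<Longrightarrow>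
    elementary_extension D L (field_adjoin M {\<theta>})"

definition has_elementary_integral :: "('a::field \<Rightarrow> 'a) \<Rightarrow> 'a set \<Rightarrow> 'a \<Rightarrow> bool" where
  "has_elementary_integral D L f \<longleftrightarrow> (\<exists>M. elementary_extension D L M \<and> (\<exists>g\<in>M. f = D g))"

text \<open>\<open>pole_defect\<close> is \<open>\<eta>\<^sub>P\<close>, \<open>pole_shift\<close> is \<open>\<delta>\<^sub>P\<close>.\<close>

definition pole_defect :: "('a::field \<Rightarrow> 'a) \<Rightarrow> 'a set \<Rightarrow> 'a set \<Rightarrow> ereal" where
  "pole_defect D R P = max 0 (SUP a\<in>R - {0}. - prime_val R P (D a))"

definition pole_shift :: "('a::field \<Rightarrow> 'a) \<Rightarrow> 'a set \<Rightarrow> 'a set \<Rightarrow> ereal" where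
  "pole_shift D R P = 1 + pole_defect D R P"

definition normal_prime :: "('a::field \<Rightarrow> 'a) \<Rightarrow> 'a set \<Rightarrow> 'a set \<Rightarrow> bool" where
  "normal_prime D R P \<longleftrightarrow> height_one_prime R P \<and>
     (\<exists>\<pi>. uniformiser R P \<pi> \<and> pole_defect D R P + prime_val R P (D \<pi>) = 0)"

definition special_prime :: "('a::field \<Rightarrow> 'a) \<Rightarrow> 'a set \<Rightarrow> 'a set \<Rightarrow> bool" where
  "special_prime D R P \<longleftrightarrow> height_one_prime R P \<and> \<not> normal_prime D R P"

definition div_support :: "'a::field set \<Rightarrow> 'a \<Rightarrow> 'a set set" where
  "div_support R u = {P. height_one_prime R P \<and> prime_val R P u \<noteq> 0}"

definition log_support :: "('a::field \<Rightarrow> 'a) \<Rightarrow> 'a set \<Rightarrow> 'a \<Rightarrow> 'a set set" where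
  "log_support D R f = {P. special_prime D R P} \<union>
     {P. normal_prime D R P \<and> prime_val R P f \<le> - pole_shift D R P}"

section \<open>The tower\<close>

text \<open>\<open>lower_field F t i\<close> is \<open>F(t\<^sub>1,\<dots>,t\<^sub>i)\<close>, and \<open>upper_field F t j y i\<close> is
  \<open>K\<^sub>0(y)(t\<^sub>j\<^sub>+\<^sub>1,\<dots>,t\<^sub>i)\<close> with \<open>K\<^sub>0 = F(t\<^sub>1,\<dots>,t\<^sub>j)\<close>; the latter is \<open>K\<^sub>0(y)\<close> for \<open>i = j\<close>.\<close>

definition lower_field :: "'a::field set \<Rightarrow> (nat \<Rightarrow> 'a) \<Rightarrow> nat \<Rightarrow> 'a set" where
  "lower_field F t i = field_adjoin F (t ` {1..i})"

definition lower_ring :: "'a::field set \<Rightarrow> (nat \<Rightarrow> 'a) \<Rightarrow> nat \<Rightarrow> 'a set" where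
  "lower_ring F t i = ring_adjoin F (t ` {1..i})"

definition upper_field :: "'a::field set \<Rightarrow> (nat \<Rightarrow> 'a) \<Rightarrow> nat \<Rightarrow> 'a \<Rightarrow> nat \<Rightarrow> 'a set" where
  "upper_field F t j y i = field_adjoin (field_adjoin (lower_field F t j) {y}) (t ` {j+1..i})"

text \<open>The ring \<open>\<A> = \<O>[t\<^sub>j\<^sub>+\<^sub>1,\<dots>,t\<^sub>n]\<close>, where \<open>\<O>\<close> is the integral closure of
  \<open>R\<^sub>0 = F[t\<^sub>1,\<dots>,t\<^sub>j]\<close> in \<open>K\<^sub>0(y)\<close>.\<close>

definition tower_ring :: "'a::field set \<Rightarrow> (nat \<Rightarrow> 'a) \<Rightarrow> nat \<Rightarrow> 'a \<Rightarrow> nat \<Rightarrow> 'a set" where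
  "tower_ring F t j y n =
     ring_adjoin (integral_closure_in (lower_ring F t j) (field_adjoin (lower_field F t j) {y}))
       (t ` {j+1..n})"

text \<open>
  \<open>Fbar\<close> is an algebraic closure of \<open>F\<close>. Since \<open>F\<close> is the field of constants of \<open>L\<close>, it is
  algebraically closed in \<open>L\<close>, so \<open>Fbar \<otimes>\<^sub>F L\<close> is a field; hence \<open>Fbar \<otimes>\<^sub>F \<A>\<close> and the
  differential field \<open>Fbar L\<close> are the subring and the subfield of the ambient field generated by
  \<open>Fbar\<close> and \<open>\<A>\<close>, respectively by \<open>Fbar\<close> and \<open>L\<close>.
\<close>

locale differential_tower =
  fixes D :: "'a::field_char_0 \<Rightarrow> 'a"
    and F Fbar :: "'a set"
    and t :: "nat \<Rightarrow> 'a"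
    and j :: nat
    and y :: 'a
    and m :: nat
    and q :: 'a
    and n :: nat
  assumes derivation: "is_derivation D"
    and subfield_F: "is_subfield F"
    and algebraic_closure_F: "is_algebraic_closure F Fbar"
    and D_Fbar: "\<forall>c\<in>Fbar. D c = 0"
    and j_less_n: "j < n"
    and D_F: "D ` F \<subseteq> F"
    and lower_transcendental: "\<forall>i\<in>{1..j}. transcendental_over (lower_field F t (i - 1)) (t i)"
    and lower_derivative: "\<forall>i\<in>{1..j}. D (t i) \<in> lower_field F t i"
    and m_pos: "m \<ge> 1"
    and radicand: "q \<in> lower_ring F t j" "y ^ m = q"
    and radicand_power_free: "power_free_in (lower_ring F t j) m q"
    and radical_irreducible:
      "irreducible_in (poly_over (lower_field Fbar t j)) (monom 1 m - [:q:])"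
    and upper_transcendental:
      "\<forall>i\<in>{j+1..n}. transcendental_over (upper_field F t j y (i - 1)) (t i)"
    and upper_derivative: "\<forall>i\<in>{j+1..n}. D (t i) \<in> upper_field F t j y i"
    and constants: "{x \<in> upper_field F t j y n. D x = 0} = F"

end

theory Submission
  imports Defs "HOL-Algebra.Algebraic_Closure_Type"
begin

text \<open>
  Let \<open>K\<close> be \<open>E\<close> with all constants of \<open>Fbar\<close> adjoined. Expand an element of \<open>K(t)\<close> in descending
  powers of \<open>t\<close>, say \<open>v = a t\<^sup>d + b t\<^sup>d\<^sup>-\<^sup>1 + \<dots>\<close> with \<open>a \<noteq> 0\<close>, and read off the degree of \<open>D v\<close>. In the
  primitive and in the hyperexponential case \<open>D\<close> does not raise degrees, so every \<open>D u / u\<close> has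
  degree at most \<open>0\<close>; since \<open>E(t)\<close> has no new constants, \<open>D v\<close> has degree at least \<open>d - 1\<close> (if
  \<open>d \<noteq> 0\<close>), respectively degree \<open>d\<close> (if \<open>d > 0\<close>). In the hypertangent case \<open>D v \<equiv> d w t v\<close> up to terms of
  degree \<open>d\<close>, so \<open>D\<close> raises every nonzero degree by one and \<open>D u / u \<equiv> deg(u) w t\<close> up to terms of
  degree \<open>0\<close>. Hence if \<open>f\<close> and \<open>D v\<close> have no term in \<open>t\<close>, then \<open>\<Sum> c\<^sub>i deg(u\<^sub>i) = 0\<close>.
\<close>

hide_const (open) up_ring.coeff up_ring.monom Polynomials.degree Polynomials.lead_coeff

section \<open>Subrings and subfields\<close>

lemma is_subring_closed:
  assumes "is_subring R"
  shows "0 \<in> R" "1 \<in> R" "x \<in> R \<Longrightarrow> - x \<in> R"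
    "x \<in> R \<Longrightarrow> y \<in> R \<Longrightarrow> x + y \<in> R" "x \<in> R \<Longrightarrow> y \<in> R \<Longrightarrow> x - y \<in> R"
    "x \<in> R \<Longrightarrow> y \<in> R \<Longrightarrow> x * y \<in> R" "x \<in> R \<Longrightarrow> x ^ k \<in> R"
    "of_nat k \<in> R"  "of_int i \<in> R"
proof -
  show one: "1 \<in> R" using assms by (simp add: is_subring_def)
  have diff: "x - y \<in> R" if "x \<in> R" "y \<in> R" for x y using assms that by (simp add: is_subring_def)
  have mult: "x * y \<in> R" if "x \<in> R" "y \<in> R" for x y using assms that by (simp add: is_subring_def)
  show zero: "0 \<in> R" using diff[OF one one] by simp
  have neg: "- x \<in> R" if "x \<in> R" for x using diff[OF zero that] by simp
  have add: "x + y \<in> R" if "x \<in> R" "y \<in> R" for x y using diff[OF that(1) neg[OF that(2)]] by simp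
  show nat: "of_nat k \<in> R" for k by (induction k) (simp_all add: zero one add)
  show "of_int i \<in> R" by (cases i rule: int_cases2) (simp_all add: nat neg)
  show "x ^ k \<in> R" if "x \<in> R" by (induction k) (simp_all add: one mult that)
  show "x \<in> R \<Longrightarrow> - x \<in> R" "x \<in> R \<Longrightarrow> y \<in> R \<Longrightarrow> x + y \<in> R"
    "x \<in> R \<Longrightarrow> y \<in> R \<Longrightarrow> x - y \<in> R" "x \<in> R \<Longrightarrow> y \<in> R \<Longrightarrow> x * y \<in> R"
    by (fact neg, fact add, fact diff, fact mult)
qed

lemma is_subfield_closed:
  assumes "is_subfield K"
  shows "is_subring K" "x \<in> K \<Longrightarrow> inverse x \<in> K" "x \<in> K \<Longrightarrow> y \<in> K \<Longrightarrow> x / y \<in> K"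
    "x \<in> K \<Longrightarrow> x powi i \<in> K"
  using assms is_subring_closed[of K]
  by (auto simp: is_subfield_def divide_inverse power_int_def)

lemma is_subfield_field_adjoin: "is_subfield (field_adjoin K S)"
  unfolding field_adjoin_def
proof (rule hull_in)
  fix T :: "'a set set"
  assume "Ball T is_subfield"
  then show "is_subfield (\<Inter>T)" by (simp add: is_subfield_def is_subring_def)
qed

lemma subset_field_adjoin: "K \<subseteq> field_adjoin K S" "S \<subseteq> field_adjoin K S"
  unfolding field_adjoin_def using hull_subset[of "K \<union> S" is_subfield] by auto

lemma field_adjoin_subset: "K \<subseteq> M \<Longrightarrow> S \<subseteq> M \<Longrightarrow> is_subfield M \<Longrightarrow> field_adjoin K S \<subseteq> M"
  unfolding field_adjoin_def by (rule hull_minimal) auto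

lemma field_adjoin_mono:
  "K \<subseteq> M \<Longrightarrow> S \<subseteq> T \<Longrightarrow> field_adjoin K S \<subseteq> field_adjoin M T"
  using subset_field_adjoin[of M T] subset_field_adjoin[of T M]
  by (intro field_adjoin_subset is_subfield_field_adjoin) (auto simp: subset_field_adjoin(2)[THEN subsetD])

lemma sum_in_subring: "is_subring R \<Longrightarrow> (\<And>x. x \<in> A \<Longrightarrow> f x \<in> R) \<Longrightarrow> sum f A \<in> R"
  by (induction A rule: infinite_finite_induct) (auto simp: is_subring_closed)

lemma is_subring_poly_over:
  assumes "is_subring R"
  shows "is_subring (poly_over R)"
proof -
  show ?thesis
    using is_subring_closed[OF assms]
    by (auto simp: is_subring_def poly_over_def coeff_mult intro!: sum_in_subring[OF assms])
qed

lemma monom_in_poly_over: "is_subring R \<Longrightarrow> a \<in> R \<Longrightarrow> monom a k \<in> poly_over R"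
  by (auto simp: poly_over_def is_subring_closed)

lemma pCons_in_poly_over_iff: "pCons a p \<in> poly_over R \<longleftrightarrow> a \<in> R \<and> p \<in> poly_over R"
  unfolding poly_over_def mem_Collect_eq by (metis coeff_pCons_0 coeff_pCons_Suc not0_implies_Suc)

lemma poly_over_mono: "R \<subseteq> S \<Longrightarrow> poly_over R \<subseteq> poly_over S"
  by (auto simp: poly_over_def)

lemma poly_in_subring:
  assumes "is_subring R" "p \<in> poly_over R" "x \<in> R"
  shows "poly p x \<in> R"
  using assms(2)
proof (induction p)
  case (pCons a p)
  then show ?case using assms by (simp add: is_subring_closed pCons_in_poly_over_iff)
qed (simp add: is_subring_closed assms)

section \<open>Algebraic elements\<close>

text \<open>HOL-Algebra writes a polynomial as a list with the leading coefficient first, whereas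
  \<open>Poly\<close> starts at the constant term; hence \<open>rev\<close>. Carrying evaluation
  across makes the HOL-Algebra results on algebraic elements available.\<close>

lemma eval_type_algebra:
  "ring.eval (ring_of_type_algebra :: 'a::field ring) xs x = poly (Poly (rev xs)) x"
proof -
  interpret R: ring "ring_of_type_algebra :: 'a ring" by (rule ring_from_type_algebra)
  have pow: "x [^]\<^bsub>ring_of_type_algebra\<^esub> (k::nat) = x ^ k" for k
    by (induction k) (simp_all add: R.nat_pow_0 R.nat_pow_Suc, simp_all add: ring_of_type_algebra_def)
  show ?thesis
    by (induction xs)
      (simp_all add: pow Poly_append poly_monom,
       simp_all add: ring_of_type_algebra_def algebra_simps)
qed

text \<open>The list \<open>rev (coeffs p)\<close> is a HOL-Algebra polynomial because its head, the
  leading coefficient of \<open>p\<close>, is nonzero. For the same reason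
  \<open>Poly (rev p)\<close> is nonzero in the converse direction.\<close>

lemma algebraic_over_iff:
  fixes K :: "'a::field set"
  assumes "subring K ring_of_type_algebra"
  shows "algebraic_over K x \<longleftrightarrow> (ring.algebraic ring_of_type_algebra over K) x"
proof -
  interpret R: field "ring_of_type_algebra :: 'a ring" by (rule field_from_type_algebra)
  have zero: "\<zero>\<^bsub>ring_of_type_algebra\<^esub> = (0::'a)" and carrier: "carrier ring_of_type_algebra = (UNIV :: 'a set)"
    by (simp_all add: ring_of_type_algebra_def)
  have "0 \<in> K" using subringE(2)[OF assms] by (simp add: zero)
  show ?thesis
  proof
    assume "algebraic_over K x"
    then obtain p where p: "p \<in> poly_over K" "p \<noteq> 0" "poly p x = 0"
      by (auto simp: algebraic_over_def)
    have "set (coeffs p) \<subseteq> K"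
      using p(1) by (auto simp: coeffs_def poly_over_def split: if_splits)
    moreover have "hd (rev (coeffs p)) \<noteq> 0"
      using p(2) by (simp add: hd_rev last_coeffs_eq_coeff_degree)
    ultimately have "rev (coeffs p) \<in> carrier (univ_poly ring_of_type_algebra K)"
      by (simp add: univ_poly_def polynomial_def zero)
    moreover have "rev (coeffs p) \<noteq> []" using p(2) by simp
    moreover have "R.eval (rev (coeffs p)) x = \<zero>\<^bsub>ring_of_type_algebra\<^esub>"
      using p(3) by (simp add: eval_type_algebra zero)
    ultimately show "(R.algebraic over K) x" by (rule R.algebraicI)
  next
    assume "(R.algebraic over K) x"
    with assms obtain p where p: "p \<in> carrier (univ_poly ring_of_type_algebra K)" "p \<noteq> []"
      "R.eval p x = \<zero>\<^bsub>ring_of_type_algebra\<^esub>"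
      using R.algebraicE carrier by (metis UNIV_I)
    have hd: "set p \<subseteq> K" "hd p \<noteq> 0"
      using p(1,2) by (auto simp: univ_poly_def polynomial_def zero)
    have "coeff (Poly (rev p)) i \<in> K" for i
      using hd(1) \<open>0 \<in> K\<close> by (auto simp: coeff_Poly_eq nth_default_def rev_nth)
    moreover have "coeff (Poly (rev p)) (length p - 1) \<noteq> 0"
      using hd(2) p(2) by (simp add: coeff_Poly_eq nth_default_def rev_nth hd_conv_nth)
    then have "Poly (rev p) \<noteq> 0" by (metis coeff_0)
    ultimately show "algebraic_over K x"
      using p(3) unfolding algebraic_over_def poly_over_def
      by (intro bexI[of _ "Poly (rev p)"]) (simp_all add: eval_type_algebra zero)
  qed
qed

text \<open>\<open>is_subfield\<close> asks for inverses of all elements, HOL-Algebra only for those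
  of nonzero ones; the two agree because \<open>inverse 0 = 0\<close>.\<close>

lemma is_subfield_iff:
  fixes K :: "'a::field set"
  shows "is_subfield K \<longleftrightarrow> subfield K ring_of_type_algebra"
proof -
  interpret R: field "ring_of_type_algebra :: 'a ring" by (rule field_from_type_algebra)
  have ops: "\<zero>\<^bsub>ring_of_type_algebra\<^esub> = (0::'a)" "\<one>\<^bsub>ring_of_type_algebra\<^esub> = (1::'a)"
    "carrier ring_of_type_algebra = (UNIV :: 'a set)"
    "\<And>x y :: 'a. x \<oplus>\<^bsub>ring_of_type_algebra\<^esub> y = x + y"
    "\<And>x y :: 'a. x \<otimes>\<^bsub>ring_of_type_algebra\<^esub> y = x * y"
    by (simp_all add: ring_of_type_algebra_def)
  have minus: "\<ominus>\<^bsub>ring_of_type_algebra\<^esub> x = - x" for x :: 'a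
    using R.minus_equality[of "- x" x] by (simp add: ops)
  have inv: "inv\<^bsub>ring_of_type_algebra\<^esub> x = inverse x" if "x \<noteq> 0" for x :: 'a
    using R.comm_inv_char[of x "inverse x"] that by (simp add: ops)
  show ?thesis
  proof
    assume K: "is_subfield K"
    then have diff: "x - y \<in> K" if "x \<in> K" "y \<in> K" for x y
      using that by (simp add: is_subfield_def is_subring_def)
    have "1 \<in> K" using K by (simp add: is_subfield_def is_subring_def)
    then have "0 \<in> K" using diff[of 1 1] by simp
    then have neg: "- x \<in> K" if "x \<in> K" for x using diff[of 0 x] that by simp
    then have add: "x + y \<in> K" if "x \<in> K" "y \<in> K" for x y using diff[of x "- y"] that by simp
    show "subfield K ring_of_type_algebra"
      using K neg add
      by (intro R.subfieldI' R.subringI) (auto simp: ops minus inv is_subfield_def is_subring_def)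
  next
    assume K: "subfield K ring_of_type_algebra"
    note sub = subringE[OF subfieldE(1)[OF K]]
    have "x - y \<in> K" if "x \<in> K" "y \<in> K" for x y
      using sub(5)[OF that(2)] sub(7)[OF that(1)] by (force simp: ops minus)
    moreover have "inverse x \<in> K" if "x \<in> K" for x
      using R.subfield_m_inv(1)[OF K, of x] that by (cases "x = 0") (auto simp: ops inv)
    ultimately show "is_subfield K"
      using sub(3,6) by (auto simp: is_subfield_def is_subring_def ops)
  qed
qed

lemma is_subfield_algebraic_elements:
  assumes "is_subfield K"
  shows "is_subfield {x. algebraic_over K x}"
proof -
  interpret R: field "ring_of_type_algebra :: 'a ring" by (rule field_from_type_algebra)
  have K: "subfield K ring_of_type_algebra" using assms by (simp add: is_subfield_iff)
  have "carrier (ring_of_type_algebra :: 'a ring) = UNIV" by (simp add: ring_of_type_algebra_def)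
  then show ?thesis
    using R.subfield_of_algebraics[OF K]
    by (simp add: is_subfield_iff algebraic_over_iff[OF subfieldE(1)[OF K]])
qed

lemma algebraic_over_self:
  assumes "is_subfield K" "x \<in> K"
  shows "algebraic_over K x"
proof -
  interpret R: field "ring_of_type_algebra :: 'a ring" by (rule field_from_type_algebra)
  have "subring K ring_of_type_algebra" using assms subfieldE(1) by (auto simp: is_subfield_iff)
  then show ?thesis using R.algebraic_self assms(2) by (simp add: algebraic_over_iff)
qed

text \<open>A polynomial for \<open>x\<close> has finitely many coefficients. They generate a finite
  extension \<open>N\<close> of \<open>K\<close>, and \<open>x\<close> lies in a finite extension of
  \<open>N\<close>, hence of \<open>K\<close>. The set \<open>M\<close> may be arbitrary.\<close>

lemma algebraic_over_trans:
  assumes K: "is_subfield K" and M: "\<And>y. y \<in> M \<Longrightarrow> algebraic_over K y"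
    and x: "algebraic_over M x"
  shows "algebraic_over K x"
proof -
  interpret R: field "ring_of_type_algebra :: 'a ring" by (rule field_from_type_algebra)
  have carrier: "carrier (ring_of_type_algebra :: 'a ring) = UNIV"
    by (simp add: ring_of_type_algebra_def)
  have sK: "subfield K ring_of_type_algebra" using K by (simp add: is_subfield_iff)
  obtain p where p: "p \<in> poly_over M" "p \<noteq> 0" "poly p x = 0"
    using x by (auto simp: algebraic_over_def)
  define N where "N = R.finite_extension K (coeffs p)"
  have cK: "(R.algebraic over K) y" if "y \<in> set (coeffs p)" for y
    using that p(1) M algebraic_over_iff[OF subfieldE(1)[OF sK]]
    by (auto simp: coeffs_def poly_over_def split: if_splits)
  have N: "subfield N ring_of_type_algebra" "R.finite_dimension K N"
    unfolding N_def using cK R.finite_extension_is_subfield[OF sK, of "coeffs p"]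
      R.finite_extension_finite_dimension(1)[OF sK, of "coeffs p"] carrier by auto
  have "set (coeffs p) \<subseteq> N"
    unfolding N_def by (rule R.finite_extension_mem[OF subfieldE(1)[OF sK]]) (simp add: carrier)
  moreover have "0 \<in> N"
    using subringE(2)[OF subfieldE(1)[OF N(1)]] by (simp add: ring_of_type_algebra_def)
  ultimately have "coeff p i \<in> N" for i
    by (metis coeff_in_coeffs leI coeff_eq_0 p(2) subsetD)
  then have "algebraic_over N x" using p(2,3) by (auto simp: algebraic_over_def poly_over_def)
  then have "R.finite_dimension N (R.simple_extension N x)"
    using algebraic_over_iff[OF subfieldE(1)[OF N(1)]] R.finite_dimension_simple_extension[OF N(1)]
    by (simp add: carrier)
  then have "R.finite_dimension K (R.simple_extension N x)"
    by (rule R.telescopic_base_dim(1)[OF sK N])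
  then have "(R.algebraic over K) x"
    using R.finite_dimension_imp_algebraic[OF sK R.simple_extension_is_subring[OF subfieldE(1)[OF N(1)]]]
      R.simple_extension_mem[OF subfieldE(1)[OF N(1)]] by (simp add: carrier)
  then show ?thesis using algebraic_over_iff[OF subfieldE(1)[OF sK]] by simp
qed

text \<open>The elements algebraic over \<open>E\<close> form a field, so all of
  \<open>field_adjoin C E\<close> is algebraic over \<open>E\<close>, and transitivity applies. This
  lets the algebraic closure of the constants be adjoined below the top generator.\<close>

lemma transcendental_over_field_adjoin_algebraic:
  assumes E: "is_subfield E" and C: "\<And>c. c \<in> C \<Longrightarrow> algebraic_over E c"
    and \<tau>: "transcendental_over E \<tau>"
  shows "transcendental_over (field_adjoin C E) \<tau>"
proof -
  have "field_adjoin C E \<subseteq> {x. algebraic_over E x}"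
    using C algebraic_over_self[OF E] is_subfield_algebraic_elements[OF E]
    by (intro field_adjoin_subset) auto
  then show ?thesis
    using algebraic_over_trans[OF E, of "field_adjoin C E" \<tau>] \<tau>
    by (auto simp: transcendental_over_def)
qed

section \<open>Derivations\<close>

context
  fixes D :: "'a::field_char_0 \<Rightarrow> 'a"
  assumes D: "is_derivation D"
begin

lemma derivation_add: "D (x + y) = D x + D y"
  and derivation_mult: "D (x * y) = x * D y + D x * y"
  using D by (auto simp: is_derivation_def)

lemma derivation_0: "D 0 = 0" using derivation_add[of 0 0] by simp
lemma derivation_1: "D 1 = 0" using derivation_mult[of 1 1] by simp
lemma derivation_minus: "D (- x) = - D x"
  using derivation_add[of x "- x"] by (simp add: derivation_0 eq_neg_iff_add_eq_0 add.commute)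
lemma derivation_diff: "D (x - y) = D x - D y"
  using derivation_add[of x "- y"] by (simp add: derivation_minus)

lemma derivation_of_int: "D (of_int i) = 0"
proof -
  have "D (of_nat k) = 0" for k
    by (induction k) (simp_all add: derivation_0 derivation_1 derivation_add)
  then show ?thesis by (cases i rule: int_cases2) (simp_all add: derivation_minus)
qed

text \<open>Differentiate \<open>x * inverse x = 1\<close>; at 0 both sides vanish because
  \<open>inverse 0 = 0\<close>.\<close>

lemma derivation_inverse: "D (inverse x) = - D x * inverse x ^ 2"
proof (cases "x = 0")
  case False
  have "x * D (inverse x) + D x * inverse x = 0"
    using derivation_mult[of x "inverse x"] False by (simp add: derivation_1)
  then have "x * D (inverse x) = - D x * inverse x" by (simp add: eq_neg_iff_add_eq_0)
  moreover have "D (inverse x) = inverse x * (x * D (inverse x))"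
    using False by (simp flip: mult.assoc)
  ultimately show ?thesis by (simp add: power2_eq_square mult_ac)
qed (simp add: derivation_0)

text \<open>This form of the quotient rule keeps \<open>x / y\<close> intact, so that a degree bound
  for the quotient can be used directly.\<close>

lemma derivation_divide: "D (x / y) = (D x - x / y * D y) * inverse y"
  by (simp add: divide_inverse derivation_mult derivation_inverse power2_eq_square algebra_simps)

lemma derivation_power: "D (x ^ k) = of_nat k * x ^ (k - 1) * D x"
proof (induction k)
  case (Suc k)
  then show ?case
    by (cases k) (simp_all add: derivation_mult derivation_1 algebra_simps)
qed (simp add: derivation_1)

lemma derivation_power_int: "x \<noteq> 0 \<Longrightarrow> D (x powi i) = of_int i * x powi (i - 1) * D x"
proof -
  assume x: "x \<noteq> 0"
  have pos: "D (x powi int k) = of_nat k * x powi (int k - 1) * D x" for k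
  proof (cases k)
    case (Suc l)
    then have "int k - 1 = int l" by simp
    then show ?thesis using Suc by (simp only: power_int_of_nat derivation_power diff_Suc_1)
  qed (simp add: derivation_1)
  show ?thesis
  proof (cases i rule: int_cases2)
    case (nonneg k)
    then show ?thesis using pos[of k] by simp
  next
    case (nonpos k)
    have "x powi (int k - 1) * inverse (x powi int k) ^ 2 = x powi (- int k - 1)"
      using x by (simp add: power_int_diff power_int_minus power2_eq_square field_simps)
    then show ?thesis
      using derivation_inverse[of "x powi int k"] pos[of k] nonpos
      by (simp add: power_int_minus mult.assoc mult.left_commute del: power_int_of_nat)
  qed
qed

text \<open>Since a generated field is minimal, this reduces its closure under \<open>D\<close> to a
  check on generators.\<close>

lemma is_subfield_derivation_vimage:
  assumes "is_subfield M"
  shows "is_subfield {x \<in> M. D x \<in> M}"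
  using is_subfield_closed[OF assms] is_subring_closed[OF is_subfield_closed(1)[OF assms]]
  unfolding is_subfield_def is_subring_def
  by (auto simp: derivation_1 derivation_diff derivation_mult derivation_inverse)

lemma derivation_field_adjoin:
  assumes "\<And>x. x \<in> K \<union> S \<Longrightarrow> D x \<in> field_adjoin K S"
  shows "D ` field_adjoin K S \<subseteq> field_adjoin K S"
proof -
  have "field_adjoin K S \<subseteq> {x \<in> field_adjoin K S. D x \<in> field_adjoin K S}"
    using assms subset_field_adjoin
    by (intro field_adjoin_subset is_subfield_derivation_vimage is_subfield_field_adjoin) blast+
  then show ?thesis by auto
qed

end

section \<open>Degrees of rational functions\<close>

text \<open>The elements of \<open>K(\<tau>)\<close> whose order at \<open>\<tau> = \<infinity>\<close> is at least \<open>-d\<close>.\<close>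

definition degree_le :: "'a::field set \<Rightarrow> 'a \<Rightarrow> int \<Rightarrow> 'a set" where
  "degree_le K \<tau> d = {poly p \<tau> / poly q \<tau> | p q. p \<in> poly_over K \<and> q \<in> poly_over K \<and> q \<noteq> 0 \<and>
     (p \<noteq> 0 \<longrightarrow> int (degree p) \<le> int (degree q) + d)}"

lemma degree_le_mono: "d \<le> e \<Longrightarrow> degree_le K \<tau> d \<subseteq> degree_le K \<tau> e"
  unfolding degree_le_def by (intro Collect_mono) (metis add_left_mono order_trans)

lemma degree_le_mono_field: "K \<subseteq> M \<Longrightarrow> degree_le K \<tau> d \<subseteq> degree_le M \<tau> d"
  unfolding degree_le_def using poly_over_mono[of K M] by blast

locale transcendental_generator =
  fixes K :: "'a::field_char_0 set" and \<tau> :: 'a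
  assumes subfield: "is_subfield K" and transcendental: "transcendental_over K \<tau>"
begin

lemmas K_closed = is_subring_closed[OF is_subfield_closed(1)[OF subfield]]
  is_subfield_closed(2-)[OF subfield]

lemmas poly_closed = is_subring_closed[OF is_subring_poly_over[OF is_subfield_closed(1)[OF subfield]]]

lemma monom_closed: "a \<in> K \<Longrightarrow> monom a k \<in> poly_over K"
  by (rule monom_in_poly_over[OF is_subfield_closed(1)[OF subfield]])

lemma poly_eq_0_iff: "p \<in> poly_over K \<Longrightarrow> poly p \<tau> = 0 \<longleftrightarrow> p = 0"
  using transcendental by (auto simp: transcendental_over_def algebraic_over_def)

lemma poly_eq_iff: "p \<in> poly_over K \<Longrightarrow> q \<in> poly_over K \<Longrightarrow> poly p \<tau> = poly q \<tau> \<longleftrightarrow> p = q"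
  using poly_eq_0_iff[of "p - q"] poly_closed by auto

lemma generator_nonzero: "\<tau> \<noteq> 0"
  using poly_eq_0_iff[of "monom 1 1"] monom_closed[of 1 1] K_closed by (auto simp: poly_monom)

lemma degree_leI:
  "p \<in> poly_over K \<Longrightarrow> q \<in> poly_over K \<Longrightarrow> q \<noteq> 0 \<Longrightarrow> (p \<noteq> 0 \<Longrightarrow> int (degree p) \<le> int (degree q) + d)
    \<Longrightarrow> poly p \<tau> / poly q \<tau> \<in> degree_le K \<tau> d"
  by (auto simp: degree_le_def)

text \<open>Cross-multiplication yields an identity of polynomials, because \<open>\<tau>\<close> is
  transcendental. Comparing degrees shows that the difference of degrees does not depend on the
  chosen fraction.\<close>

lemma degree_le_iff:
  assumes "a \<in> poly_over K" "b \<in> poly_over K" "a \<noteq> 0" "b \<noteq> 0"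
  shows "poly a \<tau> / poly b \<tau> \<in> degree_le K \<tau> d \<longleftrightarrow> int (degree a) - int (degree b) \<le> d"
proof
  assume "poly a \<tau> / poly b \<tau> \<in> degree_le K \<tau> d"
  then obtain p q where pq: "p \<in> poly_over K" "q \<in> poly_over K" "q \<noteq> 0"
    "p \<noteq> 0 \<Longrightarrow> int (degree p) \<le> int (degree q) + d" "poly a \<tau> / poly b \<tau> = poly p \<tau> / poly q \<tau>"
    by (auto simp: degree_le_def)
  have "poly (a * q) \<tau> = poly (p * b) \<tau>"
    using pq assms by (simp add: poly_eq_0_iff frac_eq_eq)
  then have eq: "a * q = p * b" using poly_eq_iff[of "a * q" "p * b"] poly_closed(6) pq assms by blast
  then have "p \<noteq> 0" using assms pq(3) by auto
  moreover have "degree a + degree q = degree p + degree b"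
    using arg_cong[OF eq, of degree] assms pq(3) \<open>p \<noteq> 0\<close> by (simp add: degree_mult_eq)
  ultimately show "int (degree a) - int (degree b) \<le> d" using pq(4) by linarith
next
  assume "int (degree a) - int (degree b) \<le> d"
  then show "poly a \<tau> / poly b \<tau> \<in> degree_le K \<tau> d"
    using assms by (intro degree_leI) auto
qed

text \<open>Zero has degree minus infinity; this is why \<open>degree_le\<close> restricts degrees
  only for \<open>p \<noteq> 0\<close>.\<close>

lemma degree_le_zero [simp]: "0 \<in> degree_le K \<tau> d"
  using degree_leI[of 0 1 d] poly_closed(1,2) by simp

lemma degree_le_const: "a \<in> K \<Longrightarrow> a \<in> degree_le K \<tau> 0"
  using degree_leI[of "monom a 0" 1 0] poly_closed monom_closed[of a 0] by (simp add: monom_0)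

lemma degree_le_add:
  assumes "x \<in> degree_le K \<tau> d" "y \<in> degree_le K \<tau> d"
  shows "x + y \<in> degree_le K \<tau> d"
proof -
  obtain p q where pq: "p \<in> poly_over K" "q \<in> poly_over K" "q \<noteq> 0"
    "p \<noteq> 0 \<Longrightarrow> int (degree p) \<le> int (degree q) + d" "x = poly p \<tau> / poly q \<tau>"
    using assms(1) by (auto simp: degree_le_def)
  obtain r s where rs: "r \<in> poly_over K" "s \<in> poly_over K" "s \<noteq> 0"
    "r \<noteq> 0 \<Longrightarrow> int (degree r) \<le> int (degree s) + d" "y = poly r \<tau> / poly s \<tau>"
    using assms(2) by (auto simp: degree_le_def)
  have "x + y = poly (p * s + r * q) \<tau> / poly (q * s) \<tau>"
    using pq rs by (simp add: poly_eq_0_iff add_frac_eq)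
  moreover have "int (degree (p * s + r * q)) \<le> int (degree (q * s)) + d" if "p * s + r * q \<noteq> 0"
  proof (cases "p = 0 \<or> r = 0")
    case True
    then show ?thesis using pq rs that by (auto simp: degree_mult_eq)
  next
    case False
    have "degree (p * s + r * q) \<le> max (degree (p * s)) (degree (r * q))"
      by (rule degree_add_le_max)
    then show ?thesis using pq rs False by (auto simp: degree_mult_eq)
  qed
  ultimately show ?thesis using pq rs
    by (simp only:) (intro degree_leI poly_closed; auto)
qed

lemma degree_le_mult:
  assumes "x \<in> degree_le K \<tau> d" "y \<in> degree_le K \<tau> e"
  shows "x * y \<in> degree_le K \<tau> (d + e)"
proof -
  obtain p q where pq: "p \<in> poly_over K" "q \<in> poly_over K" "q \<noteq> 0"
    "p \<noteq> 0 \<Longrightarrow> int (degree p) \<le> int (degree q) + d" "x = poly p \<tau> / poly q \<tau>"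
    using assms(1) by (auto simp: degree_le_def)
  obtain r s where rs: "r \<in> poly_over K" "s \<in> poly_over K" "s \<noteq> 0"
    "r \<noteq> 0 \<Longrightarrow> int (degree r) \<le> int (degree s) + e" "y = poly r \<tau> / poly s \<tau>"
    using assms(2) by (auto simp: degree_le_def)
  have "x * y = poly (p * r) \<tau> / poly (q * s) \<tau>" using pq rs by simp
  then show ?thesis using pq rs
    by (simp only:) (intro degree_leI poly_closed; auto simp: degree_mult_eq)
qed

lemma degree_le_minus: "x \<in> degree_le K \<tau> d \<Longrightarrow> - x \<in> degree_le K \<tau> d"
  using degree_le_mult[of "- 1" 0 x d] degree_le_const[of "- 1"] K_closed by simp

lemma degree_le_diff:
  "x \<in> degree_le K \<tau> d \<Longrightarrow> y \<in> degree_le K \<tau> d \<Longrightarrow> x - y \<in> degree_le K \<tau> d"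
  using degree_le_add[of x d "- y"] degree_le_minus by simp

lemma degree_le_scale: "a \<in> K \<Longrightarrow> x \<in> degree_le K \<tau> d \<Longrightarrow> a * x \<in> degree_le K \<tau> d"
  using degree_le_mult[of a 0 x d] degree_le_const by simp

lemma degree_le_sum:
  "(\<And>i. i \<in> I \<Longrightarrow> g i \<in> degree_le K \<tau> d) \<Longrightarrow> sum g I \<in> degree_le K \<tau> d"
  by (induction I rule: infinite_finite_induct) (auto intro: degree_le_add)

section \<open>Expansion in descending powers of the generator\<close>

lemma power_int_eq_quotient:
  "a * \<tau> powi d = poly (monom a (nat d)) \<tau> / poly (monom 1 (nat (- d))) \<tau>"
  by (simp add: power_int_def poly_monom divide_inverse power_inverse)

lemma monomial_degree_le_iff:
  assumes "a \<in> K" "a \<noteq> 0"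
  shows "a * \<tau> powi d \<in> degree_le K \<tau> e \<longleftrightarrow> d \<le> e"
  unfolding power_int_eq_quotient using assms K_closed(2)
  by (subst degree_le_iff) (auto simp: degree_monom_eq intro!: monom_closed)

lemma monomial_degree_le: "a \<in> K \<Longrightarrow> d \<le> e \<Longrightarrow> a * \<tau> powi d \<in> degree_le K \<tau> e"
  using monomial_degree_le_iff by (cases "a = 0") auto

lemma monomial_degree_leD: "a * \<tau> powi d \<in> degree_le K \<tau> e \<Longrightarrow> a \<in> K \<Longrightarrow> e < d \<Longrightarrow> a = 0"
  using monomial_degree_le_iff[of a d e] by auto

text \<open>The coefficient is the quotient of the leading coefficients, or 0 if \<open>x\<close>
  already has degree below \<open>d\<close>. Repeated use produces further terms of the
  expansion.\<close>

lemma leading_term: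
  assumes "x \<in> degree_le K \<tau> d"
  obtains a where "a \<in> K" "x - a * \<tau> powi d \<in> degree_le K \<tau> (d - 1)"
proof -
  obtain p q where pq: "p \<in> poly_over K" "q \<in> poly_over K" "q \<noteq> 0"
    "p \<noteq> 0 \<Longrightarrow> int (degree p) \<le> int (degree q) + d" "x = poly p \<tau> / poly q \<tau>"
    using assms by (auto simp: degree_le_def)
  show ?thesis
  proof (cases "p \<noteq> 0 \<and> int (degree p) = int (degree q) + d")
    case False
    then have "x \<in> degree_le K \<tau> (d - 1)" using pq by (auto intro!: degree_leI)
    then show ?thesis using that[of 0] K_closed(1) by simp
  next
    case True
    define a where "a = lead_coeff p / lead_coeff q"
    have a: "a \<in> K" using pq by (auto simp: a_def poly_over_def intro!: K_closed)
    have a0: "a \<noteq> 0" using True pq(3) by (simp add: a_def)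
    \<comment> \<open>\<open>P - Q\<close> is the numerator of \<open>x - a * \<tau> powi d\<close>
      over the denominator \<open>q * monom 1 (nat (- d))\<close>; using \<open>nat d\<close> and
      \<open>nat (- d)\<close> together covers both signs of \<open>d\<close>. The factor
      \<open>a\<close> makes the top terms of \<open>P\<close> and \<open>Q\<close> cancel.\<close>
    define P Q where "P = p * monom 1 (nat (- d))" and "Q = q * monom a (nat d)"
    have PQ: "P \<in> poly_over K" "Q \<in> poly_over K" "P \<noteq> 0" "Q \<noteq> 0"
      using pq a a0 True K_closed(2) by (auto simp: P_def Q_def intro!: poly_closed monom_closed)
    have deg: "degree P = degree Q"
      using True pq(3) a0 by (auto simp: P_def Q_def degree_mult_eq degree_monom_eq)
    have "lead_coeff P = lead_coeff Q"
      unfolding P_def Q_def lead_coeff_mult lead_coeff_monom using pq(3) by (simp add: a_def)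
    then have "coeff (P - Q) (degree P) = 0" using deg by simp
    then have lt: "P - Q \<noteq> 0 \<Longrightarrow> degree (P - Q) < degree P"
      using degree_diff_le_max[of P Q] deg by (intro degree_less_if_less_eqI) simp_all
    have "x - a * \<tau> powi d = poly (P - Q) \<tau> / poly (q * monom 1 (nat (- d))) \<tau>"
      using pq generator_nonzero
      by (simp add: power_int_eq_quotient P_def Q_def poly_eq_0_iff poly_monom diff_divide_distrib)
    moreover have "poly (P - Q) \<tau> / poly (q * monom 1 (nat (- d))) \<tau> \<in> degree_le K \<tau> (d - 1)"
      using PQ pq lt K_closed(2) True
      by (intro degree_leI poly_closed monom_closed) (auto simp: P_def degree_mult_eq degree_monom_eq)
    ultimately show ?thesis using that[OF a] by simp
  qed
qed

lemma leading_term_nonzero: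
  assumes "x \<in> degree_le K \<tau> d" "x \<notin> degree_le K \<tau> (d - 1)"
  obtains a where "a \<in> K" "a \<noteq> 0" "x - a * \<tau> powi d \<in> degree_le K \<tau> (d - 1)"
proof -
  obtain a where "a \<in> K" "x - a * \<tau> powi d \<in> degree_le K \<tau> (d - 1)"
    using leading_term[OF assms(1)] .
  then show ?thesis using that[of a] assms(2) by (cases "a = 0") simp_all
qed

section \<open>The field of rational functions and its order at infinity\<close>

definition rational_functions :: "'a set" where
  "rational_functions = (\<Union>d. degree_le K \<tau> d)"

lemma rational_functionE:
  assumes "x \<in> rational_functions"
  obtains p q where "p \<in> poly_over K" "q \<in> poly_over K" "q \<noteq> 0" "x = poly p \<tau> / poly q \<tau>"
  using assms by (auto simp: rational_functions_def degree_le_def)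

lemma rational_function_cases:
  assumes "x \<in> rational_functions" "x \<noteq> 0"
  obtains a b where "a \<in> poly_over K" "b \<in> poly_over K" "a \<noteq> 0" "b \<noteq> 0" "x = poly a \<tau> / poly b \<tau>"
proof -
  obtain p q where "p \<in> poly_over K" "q \<in> poly_over K" "q \<noteq> 0" "x = poly p \<tau> / poly q \<tau>"
    using rational_functionE[OF assms(1)] .
  with assms(2) that[of p q] show ?thesis by (cases "p = 0") simp_all
qed

text \<open>This links the filtration \<open>degree_le\<close> to the definite description in
  \<open>infinity_val\<close>: the degree \<open>d\<close> is the least bound, and the order at
  infinity is its negative.\<close>

lemma rational_function_degree:
  assumes "x \<in> rational_functions" "x \<noteq> 0"
  obtains d where "\<And>e. x \<in> degree_le K \<tau> e \<longleftrightarrow> d \<le> e" "inverse x \<in> degree_le K \<tau> (- d)"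
    "infinity_val K \<tau> x = ereal (of_int (- d))"
proof -
  obtain a b where ab: "a \<in> poly_over K" "b \<in> poly_over K" "a \<noteq> 0" "b \<noteq> 0" "x = poly a \<tau> / poly b \<tau>"
    using rational_function_cases[OF assms] .
  define d where "d = int (degree a) - int (degree b)"
  have iff: "x \<in> degree_le K \<tau> e \<longleftrightarrow> d \<le> e" for e
    using degree_le_iff[OF ab(1-4)] ab(5) by (simp add: d_def)
  have "(THE k::int. \<exists>a\<in>poly_over K. \<exists>b\<in>poly_over K. a \<noteq> 0 \<and> b \<noteq> 0 \<and>
        x = poly a \<tau> / poly b \<tau> \<and> k = int (degree b) - int (degree a)) = - d"
  proof (rule the_equality)
    show "\<exists>a\<in>poly_over K. \<exists>b\<in>poly_over K. a \<noteq> 0 \<and> b \<noteq> 0 \<and>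
        x = poly a \<tau> / poly b \<tau> \<and> - d = int (degree b) - int (degree a)"
      using ab by (auto simp: d_def)
  next
    fix k
    assume "\<exists>a\<in>poly_over K. \<exists>b\<in>poly_over K. a \<noteq> 0 \<and> b \<noteq> 0 \<and>
        x = poly a \<tau> / poly b \<tau> \<and> k = int (degree b) - int (degree a)"
    then obtain a' b' where "a' \<in> poly_over K" "b' \<in> poly_over K" "a' \<noteq> 0" "b' \<noteq> 0"
        "x = poly a' \<tau> / poly b' \<tau>" and k: "k = int (degree b') - int (degree a')" by blast
    then have "x \<in> degree_le K \<tau> e \<longleftrightarrow> - k \<le> e" for e
      using degree_le_iff by simp
    \<comment> \<open>The least bound is unique, as is seen by taking \<open>e\<close> to be each of
      the two candidates.\<close>
    then show "k = - d" using iff[of d] iff[of "- k"] by auto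
  qed
  then have "infinity_val K \<tau> x = ereal (of_int (- d))"
    using assms(2) by (simp add: infinity_val_def)
  moreover have "inverse x \<in> degree_le K \<tau> (- d)"
    using ab by (auto simp: d_def degree_le_iff)
  ultimately show ?thesis using that iff by blast
qed

lemma is_subfield_rational_functions: "is_subfield rational_functions"
  unfolding is_subfield_def is_subring_def
proof (intro conjI ballI)
  show "1 \<in> rational_functions"
    using degree_le_const K_closed(2) by (auto simp: rational_functions_def)
next
  fix x y assume "x \<in> rational_functions" "y \<in> rational_functions"
  then obtain d e where xy: "x \<in> degree_le K \<tau> d" "y \<in> degree_le K \<tau> e"
    by (auto simp: rational_functions_def)
  then show "x * y \<in> rational_functions"
    using degree_le_mult unfolding rational_functions_def by blast
  have "x \<in> degree_le K \<tau> (max d e)" "y \<in> degree_le K \<tau> (max d e)"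
    using xy degree_le_mono[of d "max d e" K \<tau>] degree_le_mono[of e "max d e" K \<tau>] by auto
  then show "x - y \<in> rational_functions"
    using degree_le_diff unfolding rational_functions_def by blast
next
  fix x assume "x \<in> rational_functions"
  then show "inverse x \<in> rational_functions"
    by (cases "x = 0") (use rational_function_degree[of x] in \<open>auto simp: rational_functions_def\<close>)
qed

lemma generator_degree_le: "\<tau> \<in> degree_le K \<tau> 1"
  using monomial_degree_le[of 1 1 1] K_closed(2) by simp

lemma subset_rational_functions: "K \<subseteq> rational_functions" "\<tau> \<in> rational_functions"
  using degree_le_const generator_degree_le by (auto simp: rational_functions_def)

end

section \<open>Derivatives of rational functions\<close>

locale differential_generator = transcendental_generator K \<tau> for K :: "'a::field_char_0 set" and \<tau> +
  fixes D :: "'a \<Rightarrow> 'a"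
  assumes derivation: "is_derivation D" and D_closed: "x \<in> K \<Longrightarrow> D x \<in> K"
begin

lemmas D_simps = derivation_0[OF derivation] derivation_add[OF derivation]
  derivation_mult[OF derivation] derivation_diff[OF derivation]

lemma D_monomial:
  "D (a * \<tau> powi d) = D a * \<tau> powi d + of_int d * a * D \<tau> * \<tau> powi (d - 1)"
  using generator_nonzero by (simp add: D_simps derivation_power_int[OF derivation] mult_ac add.commute)

lemma generator_mult_power_int: "\<tau> * \<tau> powi d = \<tau> powi (d + 1)" "\<tau> * \<tau> powi (d - 1) = \<tau> powi d"
  using generator_nonzero by (simp_all add: power_int_add power_int_diff)

text \<open>The number \<open>e\<close> bounds how far \<open>D\<close> raises degrees: it will be 0
  in the primitive and hyperexponential cases and 1 in the hypertangent case. The induction follows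
  Horner's scheme.\<close>

lemma degree_le_derivation_poly:
  assumes "D \<tau> \<in> degree_le K \<tau> (1 + e)" "0 \<le> e" "p \<in> poly_over K"
  shows "D (poly p \<tau>) \<in> degree_le K \<tau> (int (degree p) + e)"
  using assms(3)
proof (induction p)
  case (pCons a p)
  have a: "a \<in> K" and p: "p \<in> poly_over K" using pCons.prems by (simp_all add: pCons_in_poly_over_iff)
  have Da: "D a \<in> degree_le K \<tau> k" if "0 \<le> k" for k
    using degree_le_const[OF D_closed[OF a]] degree_le_mono[OF that] by auto
  show ?case
  proof (cases "p = 0")
    case True
    then show ?thesis using Da[of "e"] assms(2) by simp
  next
    case False
    have "poly p \<tau> \<in> degree_le K \<tau> (int (degree p))"
      using degree_leI[OF p poly_closed(2), of "int (degree p)"] by simp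
    then have "D \<tau> * poly p \<tau> \<in> degree_le K \<tau> (1 + e + int (degree p))"
      by (rule degree_le_mult[OF assms(1)])
    moreover have "\<tau> * D (poly p \<tau>) \<in> degree_le K \<tau> (1 + (int (degree p) + e))"
      by (rule degree_le_mult[OF generator_degree_le pCons.IH[OF p]])
    ultimately show ?thesis
      using Da[of "1 + e + int (degree p)"] assms(2) False
      by (auto simp: D_simps add_ac intro!: degree_le_add)
  qed
qed (simp add: D_simps)

text \<open>In \<open>derivation_divide\<close> both terms of the numerator have degree at most
  \<open>degree q + d + e\<close>, and the inverse of the denominator lowers this by
  \<open>degree q\<close>.\<close>

lemma degree_le_derivation:
  assumes "D \<tau> \<in> degree_le K \<tau> (1 + e)" "0 \<le> e" "x \<in> degree_le K \<tau> d"
  shows "D x \<in> degree_le K \<tau> (d + e)"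
proof (cases "x = 0")
  case False
  obtain p q where pq: "p \<in> poly_over K" "q \<in> poly_over K" "q \<noteq> 0"
    "p \<noteq> 0 \<Longrightarrow> int (degree p) \<le> int (degree q) + d" "x = poly p \<tau> / poly q \<tau>"
    using assms(3) by (auto simp: degree_le_def)
  with False have "p \<noteq> 0" by auto
  have "D (poly p \<tau>) \<in> degree_le K \<tau> (int (degree q) + d + e)"
    using degree_le_derivation_poly[OF assms(1,2) pq(1)] pq(4)[OF \<open>p \<noteq> 0\<close>]
      degree_le_mono[of "int (degree p) + e" "int (degree q) + d + e"] by auto
  moreover have "x * D (poly q \<tau>) \<in> degree_le K \<tau> (int (degree q) + d + e)"
    using degree_le_mult[OF assms(3) degree_le_derivation_poly[OF assms(1,2) pq(2)]]
    by (simp add: add_ac)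
  moreover have "inverse (poly q \<tau>) \<in> degree_le K \<tau> (- int (degree q))"
    using degree_leI[OF poly_closed(2) pq(2,3), of "- int (degree q)"] by (simp add: divide_inverse)
  ultimately have "(D (poly p \<tau>) - x * D (poly q \<tau>)) * inverse (poly q \<tau>)
      \<in> degree_le K \<tau> (int (degree q) + d + e + - int (degree q))"
    by (rule degree_le_mult[OF degree_le_diff])
  then show ?thesis using derivation_divide[OF derivation, of "poly p \<tau>" "poly q \<tau>"] pq(5) by simp
qed (simp add: D_simps)

text \<open>With \<open>d\<close> the exact degree of \<open>u\<close>, the bound
  \<open>d + e\<close> for \<open>D u\<close> and the bound \<open>- d\<close> for
  \<open>inverse u\<close> add up to \<open>e\<close>.\<close>

lemma degree_le_log_derivative:
  assumes "D \<tau> \<in> degree_le K \<tau> (1 + e)" "0 \<le> e" "u \<in> rational_functions" "u \<noteq> 0"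
  shows "D u / u \<in> degree_le K \<tau> e"
proof -
  obtain d where "u \<in> degree_le K \<tau> d" "inverse u \<in> degree_le K \<tau> (- d)"
    using rational_function_degree[OF assms(3,4)] by (metis order_refl)
  then show ?thesis
    using degree_le_mult[OF degree_le_derivation[OF assms(1,2)], of u d "inverse u" "- d"]
    by (simp add: divide_inverse)
qed

section \<open>Derivatives for the three kinds of monomial\<close>

lemma primitive_degree:
  assumes "w \<in> K" "D \<tau> = w"
  shows "D \<tau> \<in> degree_le K \<tau> (1 + 0)"
  using degree_le_const[OF assms(1)] degree_le_mono[of 0 1] assms(2) by auto

lemma hyperexponential_degree:
  assumes "w \<in> K" "D \<tau> = w * \<tau>"
  shows "D \<tau> \<in> degree_le K \<tau> (1 + 0)"
  using degree_le_scale[OF assms(1) generator_degree_le] assms(2) by simp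

lemma hypertangent_degree:
  assumes "w \<in> K" "D \<tau> = w * (1 + \<tau>\<^sup>2)"
  shows "D \<tau> \<in> degree_le K \<tau> (1 + 1)"
proof -
  have "\<tau>\<^sup>2 \<in> degree_le K \<tau> 2"
    using degree_le_mult[OF generator_degree_le generator_degree_le] by (simp add: power2_eq_square)
  moreover have "1 \<in> degree_le K \<tau> 2"
    using degree_le_const[OF K_closed(2)] degree_le_mono[of 0 2] by auto
  ultimately show ?thesis
    using degree_le_scale[OF assms(1) degree_le_add] assms(2) by simp
qed

text \<open>If the two top coefficients of \<open>D v\<close> vanish, where \<open>v = a \<tau>\<^sup>d + b \<tau>\<^sup>d\<^sup>-\<^sup>1 + \<dots>\<close>, then
  \<open>d a \<tau> + b\<close> is a constant outside \<open>K\<close>.\<close>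

lemma primitive_derivative_degree:
  assumes w: "w \<in> K" "D \<tau> = w"
    and constants: "\<And>x. x \<in> rational_functions \<Longrightarrow> D x = 0 \<Longrightarrow> x \<in> K"
    and v: "v \<in> degree_le K \<tau> d" "v \<notin> degree_le K \<tau> (d - 1)" and "d \<noteq> 0"
  shows "D v \<notin> degree_le K \<tau> (d - 2)"
proof
  assume Dv: "D v \<in> degree_le K \<tau> (d - 2)"
  obtain a where a: "a \<in> K" "a \<noteq> 0" "v - a * \<tau> powi d \<in> degree_le K \<tau> (d - 1)"
    using leading_term_nonzero[OF v] .
  obtain b where b: "b \<in> K"
    "v - a * \<tau> powi d - b * \<tau> powi (d - 1) \<in> degree_le K \<tau> (d - 1 - 1)"
    using leading_term[OF a(3)] .
  define r where "r = v - a * \<tau> powi d - b * \<tau> powi (d - 1)"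
  have r: "D r \<in> degree_le K \<tau> (d - 2)"
    using degree_le_derivation[OF primitive_degree[OF w] _ b(2)] by (simp add: r_def)
  \<comment> \<open>This is the coefficient of \<open>\<tau> powi (d - 1)\<close> in
    \<open>D v\<close>: the first summand comes from differentiating the power in the leading term,
    the second from the coefficient \<open>b\<close>.\<close>
  define e where "e = of_int d * a * w + D b"
  have e: "e \<in> K" using a b w by (auto simp: e_def intro!: K_closed D_closed)
  have "v = a * \<tau> powi d + b * \<tau> powi (d - 1) + r" by (simp add: r_def)
  then have Dv_eq: "D v = D a * \<tau> powi d + e * \<tau> powi (d - 1) + (of_int (d - 1) * b * w) * \<tau> powi (d - 2) + D r"
    using D_monomial[of a d] D_monomial[of b "d - 1"] w(2)
    by (simp add: D_simps(2) e_def algebra_simps)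
  have "(of_int (d - 1) * b * w) * \<tau> powi (d - 2) \<in> degree_le K \<tau> (d - 2)"
    using b(1) w(1) by (intro monomial_degree_le K_closed) auto
  then have "D v - D r - (of_int (d - 1) * b * w) * \<tau> powi (d - 2) \<in> degree_le K \<tau> (d - 2)"
    by (rule degree_le_diff[OF degree_le_diff[OF Dv r]])
  moreover have "D a * \<tau> powi d + e * \<tau> powi (d - 1) = D v - D r - (of_int (d - 1) * b * w) * \<tau> powi (d - 2)"
    by (simp add: Dv_eq)
  ultimately have top: "D a * \<tau> powi d + e * \<tau> powi (d - 1) \<in> degree_le K \<tau> (d - 2)"
    by simp
  \<comment> \<open>Weakening the bound to \<open>d - 1\<close> allows the term with
    \<open>e\<close> to be dropped, which gives \<open>D a = 0\<close>; the sharper bound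
    \<open>d - 2\<close> then gives \<open>e = 0\<close>.\<close>
  then have "D a * \<tau> powi d + e * \<tau> powi (d - 1) \<in> degree_le K \<tau> (d - 1)"
    using degree_le_mono[of "d - 2" "d - 1"] by auto
  then have "D a * \<tau> powi d \<in> degree_le K \<tau> (d - 1)"
    using degree_le_diff[OF _ monomial_degree_le[OF e, of "d - 1" "d - 1"]] by fastforce
  then have Da: "D a = 0" using monomial_degree_leD D_closed[OF a(1)] by auto
  with top have e0: "e = 0" using monomial_degree_leD[of e "d - 1" "d - 2"] e by auto
  have "D (of_int d * a * \<tau> + b) = 0"
    using Da e0 w(2) by (simp add: D_simps derivation_of_int[OF derivation] e_def)
  moreover have "of_int d * a * \<tau> + b \<in> rational_functions"
    using is_subfield_rational_functions subset_rational_functions a(1) b(1)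
    by (intro is_subring_closed is_subfield_closed) auto
  ultimately have "of_int d * a * \<tau> + b \<in> K" by (rule constants[rotated])
  then have "of_int d * a * \<tau> \<in> K" using K_closed(5)[OF _ b(1)] by fastforce
  then have "of_int d * a * \<tau> powi 1 \<in> degree_le K \<tau> 0" using degree_le_const by simp
  then have "of_int d * a = 0"
    by (rule monomial_degree_leD) (use a(1) in \<open>auto intro!: K_closed\<close>)
  then show False using \<open>d \<noteq> 0\<close> a(2) by simp
qed

text \<open>\<open>D\<close> maps \<open>a * \<tau> powi d\<close> to a multiple of
  \<open>\<tau> powi d\<close>. If the top coefficient of \<open>D v\<close> vanished, this leading
  term would itself be a constant, hence in \<open>K\<close>, against \<open>d > 0\<close>.\<close>

lemma hyperexponential_derivative_degree:
  assumes w: "w \<in> K" "D \<tau> = w * \<tau>"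
    and constants: "\<And>x. x \<in> rational_functions \<Longrightarrow> D x = 0 \<Longrightarrow> x \<in> K"
    and v: "v \<in> degree_le K \<tau> d" "v \<notin> degree_le K \<tau> (d - 1)" and "d > 0"
  shows "D v \<notin> degree_le K \<tau> (d - 1)"
proof
  assume Dv: "D v \<in> degree_le K \<tau> (d - 1)"
  obtain a where a: "a \<in> K" "a \<noteq> 0" "v - a * \<tau> powi d \<in> degree_le K \<tau> (d - 1)"
    using leading_term_nonzero[OF v] .
  define r where "r = v - a * \<tau> powi d"
  have r: "D r \<in> degree_le K \<tau> (d - 1)"
    using degree_le_derivation[OF hyperexponential_degree[OF w] _ a(3)] by (simp add: r_def)
  define e where "e = D a + of_int d * a * w"
  have e: "e \<in> K" using a w by (auto simp: e_def intro!: K_closed D_closed)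
  have De: "D (a * \<tau> powi d) = e * \<tau> powi d"
    using D_monomial[of a d] generator_mult_power_int(2)[of d] w(2)
    by (simp add: e_def algebra_simps)
  then have "e * \<tau> powi d = D v - D r" by (simp add: r_def D_simps)
  then have "e * \<tau> powi d \<in> degree_le K \<tau> (d - 1)" using degree_le_diff[OF Dv r] by simp
  then have "e = 0" using monomial_degree_leD e by auto
  with De have "D (a * \<tau> powi d) = 0" by simp
  moreover have "a * \<tau> powi d \<in> rational_functions"
    using monomial_degree_le[OF a(1), of d d] by (auto simp: rational_functions_def)
  ultimately have "a * \<tau> powi d \<in> degree_le K \<tau> 0" using constants degree_le_const by blast
  then show False using monomial_degree_leD[OF _ a(1)] \<open>d > 0\<close> a(2) by blast
qed

text \<open>On the leading term the part \<open>\<tau>\<^sup>2\<close> of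
  \<open>1 + \<tau>\<^sup>2\<close> produces the subtracted product and the part 1 a term in
  \<open>\<tau> powi (d - 1)\<close>. The remainder \<open>r\<close> has degree at most
  \<open>d - 1\<close>, so \<open>D r\<close> and \<open>\<tau> * r\<close> have degree at most
  \<open>d\<close>.\<close>

lemma hypertangent_derivative:
  assumes w: "w \<in> K" "D \<tau> = w * (1 + \<tau>\<^sup>2)" and x: "x \<in> degree_le K \<tau> d"
  shows "D x - of_int d * w * \<tau> * x \<in> degree_le K \<tau> d"
proof -
  obtain a where a: "a \<in> K" "x - a * \<tau> powi d \<in> degree_le K \<tau> (d - 1)"
    using leading_term[OF x] .
  define r where "r = x - a * \<tau> powi d"
  have Dr: "D r \<in> degree_le K \<tau> d"
    using degree_le_derivation[OF hypertangent_degree[OF w] _ a(2)] by (simp add: r_def)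
  have "\<tau> * r \<in> degree_le K \<tau> d"
    using degree_le_mult[OF generator_degree_le a(2)] by (simp add: r_def)
  then have r: "of_int d * w * (\<tau> * r) \<in> degree_le K \<tau> d"
    using w(1) by (intro degree_le_scale[of "of_int d * w"] K_closed)
  have m: "D a * \<tau> powi d \<in> degree_le K \<tau> d" "(of_int d * a * w) * \<tau> powi (d - 1) \<in> degree_le K \<tau> d"
    using a(1) w(1) by (auto intro!: monomial_degree_le K_closed D_closed)
  have "\<tau>\<^sup>2 * \<tau> powi (d - 1) = \<tau> * \<tau> powi d"
    using generator_mult_power_int(2)[of d] by (simp add: power2_eq_square)
  then have "D x - of_int d * w * \<tau> * x =
      D a * \<tau> powi d + (of_int d * a * w) * \<tau> powi (d - 1) + D r - of_int d * w * (\<tau> * r)"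
    using D_monomial[of a d] w(2) by (simp add: r_def D_simps(4) algebra_simps)
  then show ?thesis using degree_le_diff[OF degree_le_add[OF degree_le_add[OF m] Dr] r] by simp
qed

text \<open>Otherwise \<open>of_int d * w * \<tau> * v\<close> would have degree at most
  \<open>d\<close>, and dividing by \<open>of_int d * w * \<tau>\<close> would put \<open>v\<close>
  in degree \<open>d - 1\<close>.\<close>

lemma hypertangent_derivative_degree:
  assumes w: "w \<in> K" "w \<noteq> 0" "D \<tau> = w * (1 + \<tau>\<^sup>2)"
    and v: "v \<in> degree_le K \<tau> d" "v \<notin> degree_le K \<tau> (d - 1)" and "d \<noteq> 0"
  shows "D v \<notin> degree_le K \<tau> d"
proof
  assume "D v \<in> degree_le K \<tau> d"
  then have "of_int d * w * \<tau> * v \<in> degree_le K \<tau> d"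
    using degree_le_diff[OF _ hypertangent_derivative[OF w(1,3) v(1)]] by fastforce
  moreover have "inverse (of_int d * w) * \<tau> powi (- 1) \<in> degree_le K \<tau> (- 1)"
    using w(1) by (intro monomial_degree_le K_closed) auto
  ultimately have "inverse (of_int d * w) * \<tau> powi (- 1) * (of_int d * w * \<tau> * v) \<in> degree_le K \<tau> (- 1 + d)"
    by (rule degree_le_mult[rotated])
  moreover have "inverse (of_int d * w) * \<tau> powi (- 1) * (of_int d * w * \<tau> * v) = v"
    using w(2) \<open>d \<noteq> 0\<close> generator_nonzero by (simp add: field_simps power_int_minus)
  ultimately have "v \<in> degree_le K \<tau> (- 1 + d)" by (simp only:)
  then show False using v(2) by simp
qed

end

section \<open>The tower\<close>

context differential_tower
begin

lemma D_lower_field: "D ` lower_field F t j \<subseteq> lower_field F t j"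
  unfolding lower_field_def
proof (rule derivation_field_adjoin[OF derivation])
  fix x assume "x \<in> F \<union> t ` {1..j}"
  then consider "x \<in> F" | k where "k \<in> {1..j}" "x = t k" by auto
  then show "D x \<in> field_adjoin F (t ` {1..j})"
  proof cases
    case 1
    then show ?thesis using D_F subset_field_adjoin(1)[of F "t ` {1..j}"] by auto
  next
    case 2
    then have "lower_field F t k \<subseteq> field_adjoin F (t ` {1..j})"
      unfolding lower_field_def by (intro field_adjoin_mono image_mono) auto
    then show ?thesis using 2 lower_derivative by auto
  qed
qed

text \<open>Differentiating \<open>y ^ m = q\<close> expresses \<open>D y\<close> through
  \<open>D q\<close> and \<open>y\<close>, and \<open>D q\<close> lies in the lower field.\<close>

lemma D_field_adjoin_radical:
  "D ` field_adjoin (lower_field F t j) {y} \<subseteq> field_adjoin (lower_field F t j) {y}" (is "_ \<subseteq> ?M")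
proof (rule derivation_field_adjoin[OF derivation])
  fix x assume x: "x \<in> lower_field F t j \<union> {y}"
  note M = is_subfield_field_adjoin[of "lower_field F t j" "{y}"]
  note closed = is_subring_closed[OF is_subfield_closed(1)[OF M]] is_subfield_closed(2-)[OF M]
  have sub: "lower_field F t j \<subseteq> ?M" "y \<in> ?M"
    using subset_field_adjoin(1) subset_field_adjoin(2)[of "{y}" "lower_field F t j"] by auto
  have "D y \<in> ?M"
  \<comment> \<open>The formula for \<open>D y\<close> divides by
    \<open>y ^ (m - 1)\<close>.\<close>
  proof (cases "y = 0")
    case True
    then show ?thesis using derivation_0[OF derivation] closed(1) by simp
  next
    case False
    have "lower_ring F t j \<subseteq> lower_field F t j"
      unfolding lower_ring_def ring_adjoin_def lower_field_def
      by (intro hull_minimal is_subfield_closed is_subfield_field_adjoin)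
        (simp add: subset_field_adjoin)
    then have "D q \<in> ?M" using radicand(1) D_lower_field sub(1) by blast
    moreover have "D q = of_nat m * y ^ (m - 1) * D y"
      using derivation_power[OF derivation, of y m] radicand(2) by simp
    then have "D y = D q / (of_nat m * y ^ (m - 1))" using False m_pos by simp
    ultimately show ?thesis using closed sub(2) by auto
  qed
  then show "D x \<in> ?M" using x D_lower_field sub(1) by auto
qed

lemma D_upper_field:
  assumes "i \<le> n"
  shows "D ` upper_field F t j y i \<subseteq> upper_field F t j y i"
  unfolding upper_field_def
proof (rule derivation_field_adjoin[OF derivation])
  let ?K = "field_adjoin (lower_field F t j) {y}"
  fix x assume "x \<in> ?K \<union> t ` {j+1..i}"
  then consider "x \<in> ?K" | k where "k \<in> {j+1..i}" "x = t k" by auto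
  then show "D x \<in> field_adjoin ?K (t ` {j+1..i})"
  proof cases
    case 1
    then show ?thesis
      using D_field_adjoin_radical subset_field_adjoin(1)[of ?K "t ` {j+1..i}"] by auto
  next
    case 2
    then have "upper_field F t j y k \<subseteq> field_adjoin ?K (t ` {j+1..i})"
      unfolding upper_field_def by (intro field_adjoin_mono image_mono) auto
    moreover have "D x \<in> upper_field F t j y k" using 2 upper_derivative assms by auto
    ultimately show ?thesis by auto
  qed
qed

lemma is_subfield_upper_field: "is_subfield (upper_field F t j y i)"
  unfolding upper_field_def by (rule is_subfield_field_adjoin)

lemma F_subset_upper_field: "F \<subseteq> upper_field F t j y i"
  unfolding upper_field_def lower_field_def using subset_field_adjoin(1) by blast

lemma upper_field_mono: "i \<le> k \<Longrightarrow> upper_field F t j y i \<subseteq> upper_field F t j y k"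
  unfolding upper_field_def by (intro field_adjoin_mono image_mono) auto

lemma top_generator_in_upper_field: "t n \<in> upper_field F t j y n"
  unfolding upper_field_def using j_less_n
  by (intro subset_field_adjoin(2)[THEN subsetD]) auto

lemma differential_generator_top: "differential_generator (upper_field F t j y (n - 1)) (t n) D"
  using is_subfield_upper_field upper_transcendental j_less_n derivation D_upper_field[of "n - 1"]
  by unfold_locales auto

text \<open>The \<open>u i\<close> of the theorem lie in \<open>Fbar L\<close> and orders are taken
  over \<open>Fbar E\<close>, so degrees are needed over that field too. Elements of
  \<open>Fbar\<close> are algebraic over \<open>F\<close>, hence over \<open>E\<close>, and
  \<open>t n\<close> stays transcendental.\<close>

lemma differential_generator_top_closed_constants:
  "differential_generator (field_adjoin Fbar (upper_field F t j y (n - 1))) (t n) D"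
proof -
  let ?E = "upper_field F t j y (n - 1)"
  interpret E: differential_generator ?E "t n" D by (rule differential_generator_top)
  have "algebraic_over ?E c" if "c \<in> Fbar" for c
  proof -
    have "algebraic_over F c" using algebraic_closure_F that by (simp add: is_algebraic_closure_def)
    then show ?thesis using poly_over_mono[OF F_subset_upper_field] by (auto simp: algebraic_over_def)
  qed
  then have "transcendental_over (field_adjoin Fbar ?E) (t n)"
    using transcendental_over_field_adjoin_algebraic[OF E.subfield] E.transcendental by blast
  moreover have "D x \<in> field_adjoin Fbar ?E" if "x \<in> Fbar \<union> ?E" for x
    using that D_Fbar E.D_closed subset_field_adjoin(2)[of ?E Fbar]
      is_subring_closed(1)[OF is_subfield_closed(1)[OF is_subfield_field_adjoin]] by auto
  then have "D ` field_adjoin Fbar ?E \<subseteq> field_adjoin Fbar ?E"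
    by (rule derivation_field_adjoin[OF derivation])
  ultimately show ?thesis
    using derivation is_subfield_field_adjoin by unfold_locales auto
qed

text \<open>Identifying \<open>L\<close> with \<open>E(t n)\<close> gives every element of
  \<open>L\<close> a degree in \<open>t n\<close>.\<close>

lemma rational_functions_top:
  "transcendental_generator.rational_functions (upper_field F t j y (n - 1)) (t n) = upper_field F t j y n"
proof -
  let ?E = "upper_field F t j y (n - 1)"
  interpret E: differential_generator ?E "t n" D by (rule differential_generator_top)
  show ?thesis
  proof
    have E_L: "?E \<subseteq> upper_field F t j y n" by (rule upper_field_mono) simp
    show "E.rational_functions \<subseteq> upper_field F t j y n"
    proof
      fix x assume "x \<in> E.rational_functions"
      then obtain p q where pq: "p \<in> poly_over ?E" "q \<in> poly_over ?E" "x = poly p (t n) / poly q (t n)"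
        by (rule E.rational_functionE)
      have "poly s (t n) \<in> upper_field F t j y n" if "s \<in> poly_over ?E" for s
        using that poly_over_mono[OF E_L] is_subfield_closed(1)[OF is_subfield_upper_field]
        by (intro poly_in_subring top_generator_in_upper_field) auto
      then show "x \<in> upper_field F t j y n"
        using pq is_subfield_closed(3)[OF is_subfield_upper_field] by simp
    qed
    have "t k \<in> E.rational_functions" if "k \<in> {j+1..n}" for k
    proof (cases "k = n")
      case False
      then have "t k \<in> ?E"
        unfolding upper_field_def using that by (intro subset_field_adjoin(2)[THEN subsetD]) auto
      then show ?thesis using E.subset_rational_functions by auto
    next
      case True
      then show ?thesis using E.subset_rational_functions(2) by (simp only:)
    qed
    moreover have "field_adjoin (lower_field F t j) {y} \<subseteq> ?E"
      unfolding upper_field_def by (rule subset_field_adjoin)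
    ultimately show "upper_field F t j y n \<subseteq> E.rational_functions"
      unfolding upper_field_def[of F t j y n] using E.subset_rational_functions
      by (intro field_adjoin_subset[OF _ _ E.is_subfield_rational_functions, of "field_adjoin _ _"] image_subsetI) blast+
  qed
qed

end

section \<open>The bounds at infinity\<close>

theorem theorem8p2:
  fixes D :: "'a::field_char_0 \<Rightarrow> 'a"
    and F Fbar E L FL FA :: "'a set"
    and t :: "nat \<Rightarrow> 'a" and j m n r :: nat and y q f v :: 'a
    and c u :: "nat \<Rightarrow> 'a"
    and vinf :: "'a \<Rightarrow> ereal"
  assumes tower: "differential_tower D F Fbar t j y m q n"
    and E: "E = upper_field F t j y (n - 1)"
    and L: "L = upper_field F t j y n"
    and FL: "FL = field_adjoin Fbar L"
    and FA: "FA = ring_adjoin Fbar (tower_ring F t j y n)"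
    and vinf: "vinf = infinity_val (field_adjoin Fbar E) (t n)"
    and monomial: "is_primitive D E (t n) \<or> is_hyperexponential D E (t n) \<or> is_hypertangent D E (t n)"
    and f: "f \<in> L" "f \<noteq> 0" "has_elementary_integral D L f"
    and v: "v \<in> L"
    and c: "\<forall>i\<in>{1..r}. c i \<in> Fbar"
    and u: "\<forall>i\<in>{1..r}. u i \<in> FL \<and> u i \<noteq> 0"
    and representation: "f = D v + (\<Sum>i=1..r. c i * (D (u i) / u i))"
    and A: "\<forall>P. normal_prime D FA P \<longrightarrow>
      prime_val FA P v \<ge> min 0 (prime_val FA P f + pole_shift D FA P) \<and>
      (prime_val FA P v < 0 \<longrightarrow> prime_val FA P v = prime_val FA P f + pole_shift D FA P)"
    and B: "\<forall>i\<in>{1..r}. div_support FA (u i) \<subseteq> log_support D FA f"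
  shows "(is_primitive D E (t n) \<longrightarrow> vinf v \<ge> min 0 (vinf f) - 1) \<and>
    (is_hyperexponential D E (t n) \<longrightarrow> vinf v \<ge> min 0 (vinf f)) \<and>
    (is_hypertangent D E (t n) \<longrightarrow>
      vinf v \<ge> min 0 (vinf f + 1) \<and>
      (rationally_independent {1..r} c \<longrightarrow> \<not> vinf f \<le> -1 \<longrightarrow> (\<forall>i\<in>{1..r}. vinf (u i) = 0)))"
proof -
  interpret T: differential_tower D F Fbar t j y m q n by (rule tower)
  \<comment> \<open>Two base fields are used side by side: the constants of
    \<open>E(t n) = L\<close> are known, while the logarithmic terms live over
    \<open>K\<close>.\<close>
  define K where "K = field_adjoin Fbar E"
  interpret E: differential_generator E "t n" D unfolding E by (rule T.differential_generator_top)
  interpret K: differential_generator K "t n" D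
    unfolding E K_def by (rule T.differential_generator_top_closed_constants)
  have L_E: "E.rational_functions = L" unfolding E L by (rule T.rational_functions_top)
  have E_K: "E \<subseteq> K" "Fbar \<subseteq> K" unfolding K_def by (rule subset_field_adjoin)+
  have degree_E_K: "degree_le E (t n) d \<subseteq> degree_le K (t n) d" for d
    by (rule degree_le_mono_field[OF E_K(1)])
  have L_K: "L \<subseteq> K.rational_functions"
    unfolding L_E[symmetric] E.rational_functions_def K.rational_functions_def
    using degree_E_K by blast
  have constants: "x \<in> E" if "x \<in> E.rational_functions" "D x = 0" for x
  proof -
    have "x \<in> F" using that T.constants unfolding L_E L by blast
    then show ?thesis using T.F_subset_upper_field unfolding E by blast
  qed
  have FL_K: "FL \<subseteq> K.rational_functions"
    unfolding FL using L_K E_K(2) K.subset_rational_functions(1)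
    by (intro field_adjoin_subset K.is_subfield_rational_functions) auto
  have c_K: "c i \<in> K" if "i \<in> {1..r}" for i using that c E_K by auto
  have u_K: "u i \<in> K.rational_functions" "u i \<noteq> 0" if "i \<in> {1..r}" for i
    using that u FL_K by auto
  define S where "S = (\<Sum>i=1..r. c i * (D (u i) / u i))"
  have Dv: "D v = f - S" using representation by (simp add: S_def)
  obtain df where df: "\<And>e. f \<in> degree_le K (t n) e \<longleftrightarrow> df \<le> e" "vinf f = ereal (of_int (- df))"
    using K.rational_function_degree[of f] f(1,2) L_K unfolding vinf K_def[symmetric] by blast
  \<comment> \<open>A fraction of polynomials over \<open>E\<close> is also one over
    \<open>K\<close>, so the degree of an element of \<open>L\<close> is the same over both
    fields.\<close>
  have v_K: "x \<in> degree_le E (t n) e \<longleftrightarrow> x \<in> degree_le K (t n) e" if "x \<in> L" for x e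
  proof (cases "x = 0")
    case False
    then obtain a b where ab: "a \<in> poly_over E" "b \<in> poly_over E" "a \<noteq> 0" "b \<noteq> 0"
      "x = poly a (t n) / poly b (t n)"
      using E.rational_function_cases[of x] \<open>x \<in> L\<close> L_E by blast
    moreover have "a \<in> poly_over K" "b \<in> poly_over K" using ab poly_over_mono[OF E_K(1)] by auto
    ultimately show ?thesis using E.degree_le_iff[of a b e] K.degree_le_iff[of a b e] by simp
  qed simp
  have Dv_L: "D v \<in> L" using v T.D_upper_field[of n] by (auto simp: L)
  have S_degree: "S \<in> degree_le K (t n) e" if "D (t n) \<in> degree_le K (t n) (1 + e)" "0 \<le> e" for e
    unfolding S_def using that c_K u_K
    by (intro K.degree_le_sum K.degree_le_scale K.degree_le_log_derivative) auto
  \<comment> \<open>The bound for \<open>f - S\<close> is found over \<open>K\<close>; as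
    \<open>D v\<close> lies in \<open>L\<close>, it descends to \<open>E\<close>.\<close>
  have Dv_degree: "D v \<in> degree_le E (t n) (max df e)" if "D (t n) \<in> degree_le K (t n) (1 + e)" "0 \<le> e" for e
    unfolding v_K[OF Dv_L] unfolding Dv using S_degree[OF that] df(1)[of "max df e"]
      degree_le_mono[of e "max df e" K "t n"] by (intro K.degree_le_diff) auto
  \<comment> \<open>It suffices to bound the exact degree of \<open>v\<close>; for
    \<open>v = 0\<close> the order is infinite.\<close>
  have v_cases: "vinf v \<ge> ereal (of_int (- B))"
    if "\<And>d. v \<in> degree_le E (t n) d \<Longrightarrow> v \<notin> degree_le E (t n) (d - 1) \<Longrightarrow> d \<le> B" for B
  proof (cases "v = 0")
    case True
    then show ?thesis by (simp add: vinf infinity_val_def)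
  next
    case False
    obtain dv where dv: "\<And>e. v \<in> degree_le K (t n) e \<longleftrightarrow> dv \<le> e" "vinf v = ereal (of_int (- dv))"
      using K.rational_function_degree[of v] v False L_K unfolding vinf K_def[symmetric] by blast
    then have "dv \<le> B" using that[of dv] v_K[OF v] by auto
    then show ?thesis using dv(2) by simp
  qed
  have primitive: "vinf v \<ge> min 0 (vinf f) - 1" if "is_primitive D E (t n)"
  proof -
    obtain w where w: "w \<in> E" "D (t n) = w" using \<open>is_primitive D E (t n)\<close> by (auto simp: is_primitive_def)
    have Dv0: "D v \<in> degree_le E (t n) (max df 0)"
      using Dv_degree[OF K.primitive_degree[of w]] w E_K(1) by auto
    \<comment> \<open>The extra 1 is the possible loss of one degree in passing from
      \<open>v\<close> to \<open>D v\<close>: a larger \<open>d\<close> would put \<open>D v\<close>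
      in degree \<open>d - 2\<close>.\<close>
    have "vinf v \<ge> ereal (of_int (- (max df 0 + 1)))"
    proof (rule v_cases, rule ccontr)
      fix d assume d: "v \<in> degree_le E (t n) d" "v \<notin> degree_le E (t n) (d - 1)" "\<not> d \<le> max df 0 + 1"
      then have "D v \<in> degree_le E (t n) (d - 2)"
        using Dv0 degree_le_mono[of "max df 0" "d - 2" E "t n"] by (smt (verit) subsetD)
      then show False using E.primitive_derivative_degree[OF w constants d(1,2)] d(3) by auto
    qed
    then show ?thesis
      by (auto simp: df(2) min_def max_def zero_ereal_def one_ereal_def split: if_splits)
  qed
  have hyperexponential: "vinf v \<ge> min 0 (vinf f)" if "is_hyperexponential D E (t n)"
  proof -
    obtain w where w: "w \<in> E" "D (t n) = w * t n"
      using \<open>is_hyperexponential D E (t n)\<close> by (auto simp: is_hyperexponential_def)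
    have Dv0: "D v \<in> degree_le E (t n) (max df 0)"
      using Dv_degree[OF K.hyperexponential_degree[of w]] w E_K(1) by auto
    have "vinf v \<ge> ereal (of_int (- max df 0))"
    proof (rule v_cases, rule ccontr)
      fix d assume d: "v \<in> degree_le E (t n) d" "v \<notin> degree_le E (t n) (d - 1)" "\<not> d \<le> max df 0"
      then have "D v \<in> degree_le E (t n) (d - 1)"
        using Dv0 degree_le_mono[of "max df 0" "d - 1" E "t n"] by (smt (verit) subsetD)
      then show False using E.hyperexponential_derivative_degree[OF w constants d(1,2)] d(3) by auto
    qed
    then show ?thesis
      by (auto simp: df(2) min_def max_def zero_ereal_def split: if_splits)
  qed
  have hypertangent: "vinf v \<ge> min 0 (vinf f + 1) \<and>
      (rationally_independent {1..r} c \<longrightarrow> \<not> vinf f \<le> -1 \<longrightarrow> (\<forall>i\<in>{1..r}. vinf (u i) = 0))"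
    if "is_hypertangent D E (t n)"
  proof -
    obtain w where w: "w \<in> E" "w \<noteq> 0" "D (t n) = w * (1 + (t n)\<^sup>2)"
      using \<open>is_hypertangent D E (t n)\<close> by (auto simp: is_hypertangent_def)
    have w_K: "w \<in> K" using w(1) E_K by auto
    \<comment> \<open>The 1 is the largest degree that the logarithmic terms can contribute
      here.\<close>
    have Dv0: "D v \<in> degree_le E (t n) (max df 1)"
      using Dv_degree[OF K.hypertangent_degree[OF w_K w(3)]] by auto
    \<comment> \<open>A larger \<open>d\<close> is positive and at least \<open>max df 1\<close>, so
      \<open>D v\<close> would have degree at most \<open>d\<close>, although \<open>D\<close>
      raises a nonzero degree by one.\<close>
    have bound: "d \<le> max (df - 1) 0"
      if d: "v \<in> degree_le E (t n) d" "v \<notin> degree_le E (t n) (d - 1)" for d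
    proof (rule ccontr)
      assume d': "\<not> d \<le> max (df - 1) 0"
      then have "D v \<in> degree_le E (t n) d"
        using Dv0 degree_le_mono[of "max df 1" d E "t n"] by (smt (verit) subsetD)
      then show False using E.hypertangent_derivative_degree[OF w d] d' by auto
    qed
    then have "vinf v \<ge> ereal (of_int (- max (df - 1) 0))" by (rule v_cases)
    then have first: "vinf v \<ge> min 0 (vinf f + 1)"
      by (auto simp: df(2) min_def max_def zero_ereal_def one_ereal_def split: if_splits)
    have second: "vinf (u i) = 0"
      if indep: "rationally_independent {1..r} c" and "\<not> vinf f \<le> -1" and i: "i \<in> {1..r}" for i
    proof -
      have df0: "df \<le> 0" using \<open>\<not> vinf f \<le> -1\<close> by (simp add: df(2) one_ereal_def)
      \<comment> \<open>By \<open>bound\<close> the degree \<open>d\<close> of \<open>v\<close> is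
        at most 0. The term by which \<open>D\<close> could raise it carries the factor
        \<open>d\<close>: it vanishes for \<open>d = 0\<close> and has degree at most 0 for
        \<open>d < 0\<close>.\<close>
      have Dv1: "D v \<in> degree_le K (t n) 0"
      proof (cases "v = 0")
        case False
        obtain d where d: "\<And>e. v \<in> degree_le E (t n) e \<longleftrightarrow> d \<le> e"
          using E.rational_function_degree[of v] v False L_E by metis
        then have "d \<le> 0" using bound[of d] df0 by auto
        have "v \<in> degree_le K (t n) d" using d v_K[OF v] by auto
        note tangent = K.hypertangent_derivative[OF w_K w(3) this]
        have "of_int d * w * (t n * v) \<in> degree_le K (t n) 0"
        proof (cases "d = 0")
          case False
          then have "t n * v \<in> degree_le K (t n) 0"
            using K.degree_le_mult[OF K.generator_degree_le, of v "- 1"] d[of "- 1"] \<open>d \<le> 0\<close> v_K[OF v, of "- 1"]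
            by simp
          then show ?thesis using w_K by (intro K.degree_le_scale[of "of_int d * w"] K.K_closed)
        qed simp
        moreover have "D v - of_int d * w * t n * v \<in> degree_le K (t n) 0"
          using tangent degree_le_mono[OF \<open>d \<le> 0\<close>] by auto
        ultimately show ?thesis using K.degree_le_add by (fastforce simp: mult.assoc)
      qed (simp add: K.D_simps)
      have "\<exists>d. u i \<in> degree_le K (t n) d \<and> inverse (u i) \<in> degree_le K (t n) (- d) \<and>
          vinf (u i) = ereal (of_int (- d))" if "i \<in> {1..r}" for i
        using K.rational_function_degree[OF u_K[OF that]] unfolding vinf K_def[symmetric]
        by (metis order_refl)
      then obtain d where d: "u i \<in> degree_le K (t n) (d i)" "inverse (u i) \<in> degree_le K (t n) (- d i)"
          "vinf (u i) = ereal (of_int (- d i))" if "i \<in> {1..r}" for i by metis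
      \<comment> \<open>Up to terms of degree 0, \<open>S\<close> equals \<open>s * w * t n\<close>,
        because each \<open>D (u i) / u i\<close> equals \<open>of_int (d i) * w * t n\<close> up to
        such terms.\<close>
      define s where "s = (\<Sum>i=1..r. of_int (d i) * c i)"
      have s: "s \<in> K" unfolding s_def
        by (rule sum_in_subring) (use c_K K.K_closed K.subfield in \<open>auto simp: is_subfield_closed\<close>)
      have "c i * (D (u i) / u i) - of_int (d i) * c i * w * t n \<in> degree_le K (t n) 0"
        if "i \<in> {1..r}" for i
      proof -
        have "(D (u i) - of_int (d i) * w * t n * u i) * inverse (u i) \<in> degree_le K (t n) (d i + - d i)"
          using d[OF that] by (intro K.degree_le_mult K.hypertangent_derivative w_K w(3))
        then have "c i * ((D (u i) - of_int (d i) * w * t n * u i) * inverse (u i)) \<in> degree_le K (t n) 0"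
          using K.degree_le_scale[OF c_K[OF that]] by (metis add.right_inverse)
        then show ?thesis using u_K(2)[OF that] by (simp add: field_simps)
      qed
      then have "(\<Sum>i=1..r. c i * (D (u i) / u i) - of_int (d i) * c i * w * t n) \<in> degree_le K (t n) 0"
        by (rule K.degree_le_sum)
      then have Ss: "S - s * w * t n \<in> degree_le K (t n) 0"
        by (simp add: S_def s_def sum_subtractf sum_distrib_right)
      have "f \<in> degree_le K (t n) 0" using df(1) df0 by simp
      \<comment> \<open>Both \<open>f\<close> and \<open>D v\<close> have degree at most 0, so
        \<open>S\<close> has no term in \<open>t n\<close> and \<open>s\<close> must vanish.\<close>
      then have "S \<in> degree_le K (t n) 0" using K.degree_le_diff[OF _ Dv1] Dv by fastforce
      then have "s * w * t n powi 1 \<in> degree_le K (t n) 0" using K.degree_le_diff[OF _ Ss] by fastforce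
      then have "s * w = 0" by (rule K.monomial_degree_leD) (use s w_K K.K_closed in auto)
      \<comment> \<open>The degrees \<open>d i\<close> are read as rational coefficients of a
        relation between the \<open>c i\<close>; independence makes each of them 0.\<close>
      then have "(\<Sum>i\<in>{1..r}. of_rat (of_int (d i)) * c i) = 0" using w(2) by (simp add: s_def)
      then have "d i = 0" using indep i unfolding rationally_independent_def by fastforce
      then show ?thesis using d(3)[OF i] by (simp add: zero_ereal_def)
    qed
    show ?thesis using first second by blast
  qed
  show ?thesis using primitive hyperexponential hypertangent by blast
qed

end
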